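(* Let $\omega:\mathbb{R}\to\mathbb{R}$ satisfy: (i) $\omega$ even; (ii) $\omega(x)\to0$ as $|x|\to\infty$ and $|\omega(x)|\le C(1+|x|)^{-1-\delta}$ for constants $C,\delta>0$; (iii) $\omega$ bounded, Lipschitz continuous and integrable; (iv) $\int_{\mathbb{R}}\omega>0$. Let $h\in\mathbb{R}$, $T>0$, and let $u_p$ be a regular 1-bump periodic solution with period $T$ of $u(x)=\int_{\mathbb{R}}\omega(x-y)H(u(y)-h)\,dy$ with $u_p(\pm a)=h$, $0<a<T/2$. Let $L:\ell^2_\infty(\mathbb{Z})\to\ell^2_\infty(\mathbb{Z})$ be the block Laurent operator $(L\mathrm{x})_i=\sum_jA_{i-j}\mathrm{x}_j$ with $A_k=\frac{1}{|u_p'(a)|}\begin{pmatrix}\omega(kT)&\omega(-2a+kT)\\ \omega(2a+kT)&\omega(kT)\end{pmatrix}$. For $q=1,2,\dots$ let $L(1+q)$ be the $2(1+q)\times2(1+q)$ block circulant matrix $$L(1+q)=\begin{pmatrix}B_0&B_1&B_2&\cdots&B_q\\ B_q&B_0&B_1&\cdots&B_{q-1}\\ \vdots&&&&\vdots\\ B_1&B_2&B_3&\cdots&B_0\end{pmatrix},\quad B_n=\frac{1}{|u_p'(a)|}\begin{pmatrix}\omega_p(nT;(1+q)T)&\omega_p(-2a+nT;(1+q)T)\\ \omega_p(2a+nT;(1+q)T)&\omega_p(nT;(1+q)T)\end{pmatrix},$$ $n=0,\dots,q$, where $\omega_p(x;P)=\sum_{k\in\mathbb{Z}}\omega(x-kP)$.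 Then $$\sigma(L)=\operatorname{cl}\Big(\bigcup_{q\ge1}\sigma\big(L(1+q)\big)\Big).$$
   Context: $H$ is the unit step function. A continuous $T$-periodic function $u$ is regular 1-bump periodic (threshold $h$) if it is bounded with bounded continuous derivative and a translate $p$ satisfies $p(\pm a)=h$, $p>h$ on $(-a,a)$, $p<h$ on $[-T/2,T/2]\setminus[-a,a]$, $p'(\pm a)\neq0$. $\ell^2_\infty(\mathbb{Z})$ is the space of bounded two-sided sequences with entries in $\mathbb{C}^2$ with the sup norm; $\sigma$ denotes spectrum and $\operatorname{cl}$ closure in $\mathbb{C}$. *)

theory Defs
  imports "HOL-Analysis.Analysis" "Jordan_Normal_Form.Char_Poly"
begin

text \<open>Unit step function (the value at 0 is irrelevant here: it only affects a null set).\<close>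
definition Hstep :: "real \<Rightarrow> real" where
  "Hstep x = (if x \<ge> 0 then 1 else 0)"

definition kernel_ok :: "(real \<Rightarrow> real) \<Rightarrow> bool" where
  "kernel_ok \<omega> \<longleftrightarrow>
     (\<forall>x. \<omega> (-x) = \<omega> x) \<and>
     (\<omega> \<longlongrightarrow> 0) at_infinity \<and>
     (\<exists>C \<delta>. C > 0 \<and> \<delta> > 0 \<and> (\<forall>x. \<bar>\<omega> x\<bar> \<le> C * (1 + \<bar>x\<bar>) powr (-1 - \<delta>))) \<and>
     bounded (range \<omega>) \<and>
     (\<exists>K. \<forall>x y. \<bar>\<omega> x - \<omega> y\<bar> \<le> K * \<bar>x - y\<bar>) \<and>
     integrable lborel \<omega> \<and>
     integral\<^sup>L lborel \<omega> > 0"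

text \<open>Regular 1-bump T-periodic function with threshold h, centred so that the bump
  is (-a,a), i.e. the translate p of the definition is u itself.\<close>
definition regular_1bump :: "(real \<Rightarrow> real) \<Rightarrow> real \<Rightarrow> real \<Rightarrow> real \<Rightarrow> bool" where
  "regular_1bump u T h a \<longleftrightarrow>
     continuous_on UNIV u \<and> (\<forall>x. u (x + T) = u x) \<and>
     bounded (range u) \<and> u differentiable_on UNIV \<and>
     continuous_on UNIV (deriv u) \<and> bounded (range (deriv u)) \<and>
     u a = h \<and> u (-a) = h \<and>
     (\<forall>x\<in>{-a<..<a}. u x > h) \<and>
     (\<forall>x\<in>{-T/2..T/2} - {-a..a}. u x < h) \<and>
     deriv u a \<noteq> 0 \<and> deriv u (-a) \<noteq> 0"

definition is_solution :: "(real \<Rightarrow> real) \<Rightarrow> real \<Rightarrow> (real \<Rightarrow> real) \<Rightarrow> bool" where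
  "is_solution \<omega> h u \<longleftrightarrow>
     (\<forall>x. u x = (LINT y|lborel. \<omega> (x - y) * Hstep (u y - h)))"

definition omega_p :: "(real \<Rightarrow> real) \<Rightarrow> real \<Rightarrow> real \<Rightarrow> real" where
  "omega_p \<omega> x P = (\<Sum>\<^sub>\<infinity>k::int. \<omega> (x - of_int k * P))"

definition linf :: "(int \<Rightarrow> complex^2) set" where
  "linf = {x. bounded (range x)}"

definition supnorm :: "(int \<Rightarrow> complex^2) \<Rightarrow> real" where
  "supnorm x = (SUP i. norm (x i))"

definition linf_spectrum :: "((int \<Rightarrow> complex^2) \<Rightarrow> (int \<Rightarrow> complex^2)) \<Rightarrow> complex set" where
  "linf_spectrum Op = {c. \<not> (\<exists>M. (\<forall>x\<in>linf. M x \<in> linf) \<and>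
       (\<exists>K. \<forall>x\<in>linf. supnorm (M x) \<le> K * supnorm x) \<and>
       (\<forall>x\<in>linf. M (\<lambda>i. Op x i - c *s x i) = x) \<and>
       (\<forall>x\<in>linf. (\<lambda>i. Op (M x) i - c *s M x i) = x))}"

text \<open>The blocks A_k of the Laurent operator (indices of type 2 are 0 and 1; d stands for the absolute value of u_p'(a)).\<close>
definition Ablock :: "(real \<Rightarrow> real) \<Rightarrow> real \<Rightarrow> real \<Rightarrow> real \<Rightarrow> int \<Rightarrow> complex^2^2" where
  "Ablock \<omega> T a d k = (\<chi> r s. complex_of_real (1 / d *
      (if r = 0 \<and> s = 0 then \<omega> (of_int k * T)
       else if r = 0 \<and> s = 1 then \<omega> (-2*a + of_int k * T)
       else if r = 1 \<and> s = 0 then \<omega> (2*a + of_int k * T)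
       else \<omega> (of_int k * T))))"

definition laurent_op :: "(int \<Rightarrow> complex^2^2) \<Rightarrow> (int \<Rightarrow> complex^2) \<Rightarrow> (int \<Rightarrow> complex^2)" where
  "laurent_op A x i = (\<Sum>\<^sub>\<infinity>j::int. A (i - j) *v x j)"

text \<open>The 2(1+q) x 2(1+q) block circulant matrix L(1+q); block (I,J) is B_{(J-I) mod (1+q)}.\<close>
definition circ_mat :: "(real \<Rightarrow> real) \<Rightarrow> real \<Rightarrow> real \<Rightarrow> real \<Rightarrow> nat \<Rightarrow> complex Matrix.mat" where
  "circ_mat \<omega> T a d q = Matrix.mat (2 * (1 + q)) (2 * (1 + q)) (\<lambda>(r, s).
      let n = (int (s div 2) - int (r div 2)) mod int (1 + q);
          P = real (1 + q) * T
      in complex_of_real (1 / d *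
        (if r mod 2 = 0 \<and> s mod 2 = 0 then omega_p \<omega> (of_int n * T) P
         else if r mod 2 = 0 \<and> s mod 2 = 1 then omega_p \<omega> (-2*a + of_int n * T) P
         else if r mod 2 = 1 \<and> s mod 2 = 0 then omega_p \<omega> (2*a + of_int n * T) P
         else omega_p \<omega> (of_int n * T) P)))"

definition mat_spectrum :: "complex Matrix.mat \<Rightarrow> complex set" where
  "mat_spectrum A = {k. eigenvalue A k}"

end

theory Submission
  imports Defs "HOL-Complex_Analysis.Great_Picard" "HOL-Real_Asymp.Real_Asymp"
begin

text \<open>
  Both spectra are governed by the symbol \<open>a(z) = (\<Sum>k. A\<^sub>k z\<^sup>k)\<close> on the unit circle, a Hermitian
  2x2 matrix with eigenvalues \<open>\<alpha>(z) \<plusminus> \<bar>\<beta>(z)\<bar>\<close>: the discrete Fourier transform shows that the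
  spectrum of \<open>L(1+q)\<close> is the union of the spectra of \<open>a(z)\<close> over the (1+q)-th roots of unity,
  and the spectrum of \<open>L\<close> is the union over the whole circle. Since the eigenvalues depend
  continuously on \<open>z\<close> and roots of unity are dense, the closure of the former is the latter.

  The hard inclusion is that \<open>L - c\<close> is invertible on bounded sequences once \<open>a(z) - c\<close> is injective
  on the circle. Instead of Wiener's lemma we use localization. Parseval over roots of unity
  gives an \<open>\<ell>\<^sup>2\<close> lower bound for finitely supported sequences and a truncated kernel. Multiplying a
  bounded sequence by tent functions of large width \<open>R\<close> produces a commutator that is small even
  when measured by the sup norm, because its \<open>\<ell>\<^sup>2\<close> norm is of order \<open>\<surd>R / R\<close>, while the tail of the kernel
  is absorbed by the supremum of the local \<open>\<ell>\<^sup>2\<close> norms over all translates. Hence \<open>L - c\<close> is bounded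
  below in the sup norm. It is onto because it can be solved explicitly for periodic right-hand
  sides, and the uniformly bounded solutions have a pointwise convergent subsequence.
\<close>

section \<open>Bilinearity and norms for complex vectors and matrices\<close>

lemma bounded_bilinear_matrix_vector_mult:
  "bounded_bilinear ((*v) :: complex^'n^'m \<Rightarrow> complex^'n \<Rightarrow> complex^'m)"
  unfolding bilinear_conv_bounded_bilinear[symmetric] bilinear_def
  by (auto intro!: linearI simp: matrix_vector_mult_def Finite_Cartesian_Product.vec_eq_iff algebra_simps sum.distrib
      scaleR_sum_right)

lemma norm_vector_smult: "norm (c *s v) = norm c * norm (v :: complex^'n)"
  by (simp add: norm_vec_def norm_mult L2_set_right_distrib)

lemma bounded_linear_vector_smult: "bounded_linear ((*s) c :: complex^'n \<Rightarrow> complex^'n)"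
  by (rule bounded_linear_intro[where K = "norm c"])
     (auto simp: norm_vector_smult Finite_Cartesian_Product.vec_eq_iff algebra_simps scaleR_conv_of_real)

lemma matrix_vector_mult_smult: "(A :: complex^'n^'m) *v (c *s v) = c *s (A *v v)"
  by (simp add: matrix_vector_mult_def Finite_Cartesian_Product.vec_eq_iff sum_distrib_left algebra_simps)

lemma mat_vector_mult: "Finite_Cartesian_Product.mat c *v v = c *s (v :: complex^'n)"
  by (simp add: matrix_vector_mult_def Finite_Cartesian_Product.mat_def
      Finite_Cartesian_Product.vec_eq_iff if_distrib[where f = "\<lambda>x. x * _"] cong: if_cong)

lemma bounded_bilinear_vector_smult:
  "bounded_bilinear ((*s) :: complex \<Rightarrow> complex^'n \<Rightarrow> complex^'n)"
  unfolding bilinear_conv_bounded_bilinear[symmetric] bilinear_def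
  by (auto intro!: linearI simp: Finite_Cartesian_Product.vec_eq_iff algebra_simps)

section \<open>Parseval over roots of unity\<close>

text \<open>Multiplication by the primitive root \<open>\<zeta>\<close> permutes the
  \<open>N\<close>-th roots of unity, so the sum equals \<open>\<zeta> powi m\<close> times itself.
  That factor differs from 1 when \<open>N\<close> does not divide \<open>m\<close>.\<close>

lemma sum_roots_unity_powi:
  assumes "N > 0"
  shows "(\<Sum>z | z ^ N = 1. z powi m :: complex) = (if int N dvd m then of_nat N else 0)"
proof (cases "int N dvd m")
  case True
  then obtain k where k: "m = int N * k" by auto
  have "z powi m = 1" if "z ^ N = 1" for z :: complex
    using that by (simp add: k power_int_mult)
  then show ?thesis
    using True card_roots_unity_eq[OF assms] by simp
next
  case False
  define \<zeta> where "\<zeta> = cis (2 * pi / real N)"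
  have \<zeta>N: "\<zeta> ^ N = 1" and "\<zeta> \<noteq> 0"
  proof -
    have "real N * (2 * pi / real N) = 2 * pi" using assms by simp
    then show "\<zeta> ^ N = 1" by (simp only: \<zeta>_def Complex.DeMoivre cis_2pi)
  qed (simp add: \<zeta>_def)
  have \<zeta>m: "\<zeta> powi m \<noteq> 1"
  proof
    assume "\<zeta> powi m = 1"
    then have "cis (of_int m * (2 * pi / real N)) = 1"
      by (simp add: \<zeta>_def cis_power_int)
    then have "cos (of_int m * (2 * pi / real N)) = 1"
      by (simp add: complex_eq_iff)
    then obtain k :: int where "of_int m * (2 * pi / real N) = of_int k * 2 * pi"
      by (auto simp: cos_one_2pi_int)
    then have "real_of_int m = of_int k * of_int (int N)"
      using assms by (simp add: field_simps)
    then have "m = k * int N"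
      by (simp only: of_int_mult[symmetric] of_int_eq_iff)
    then show False using False by simp
  qed
  let ?U = "{z::complex. z ^ N = 1}"
  have "(\<Sum>z\<in>?U. z powi m) = (\<Sum>z\<in>?U. (\<zeta> * z) powi m)"
    by (rule sum.reindex_bij_witness[where i = "\<lambda>z. \<zeta> * z" and j = "\<lambda>z. z / \<zeta>"])
       (use \<zeta>N \<open>\<zeta> \<noteq> 0\<close> in \<open>auto simp: power_mult_distrib power_divide\<close>)
  also have "\<dots> = \<zeta> powi m * (\<Sum>z\<in>?U. z powi m)"
    by (simp add: power_int_mult_distrib sum_distrib_left)
  finally have "(1 - \<zeta> powi m) * (\<Sum>z\<in>?U. z powi m) = 0"
    by (simp add: algebra_simps)
  then show ?thesis using \<zeta>m False by simp
qed

lemma norm_root_unity: "N > 0 \<Longrightarrow> z ^ N = 1 \<Longrightarrow> norm (z::complex) = 1"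
  by (metis norm_one norm_power power_eq_1_iff norm_ge_zero less_irrefl)

lemma cnj_eq_inverse: "norm z = 1 \<Longrightarrow> cnj z = inverse z"
  using complex_norm_square[of z] by (simp add: inverse_unique)

text \<open>Expanding the square produces character sums in \<open>i - j\<close>. These vanish
  unless \<open>N\<close> divides \<open>i - j\<close>, and injectivity of \<open>W\<close> modulo
  \<open>N\<close> leaves only the diagonal.\<close>

lemma parseval_roots_unity:
  fixes f :: "int \<Rightarrow> complex"
  assumes "N > 0" "finite W" and inj: "\<And>i j. i \<in> W \<Longrightarrow> j \<in> W \<Longrightarrow> int N dvd i - j \<Longrightarrow> i = j"
  shows "(\<Sum>z | z ^ N = 1. (norm (\<Sum>i\<in>W. z powi i * f i))\<^sup>2) = of_nat N * (\<Sum>i\<in>W. (norm (f i))\<^sup>2)"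
proof -
  let ?U = "{z::complex. z ^ N = 1}"
  have "complex_of_real (\<Sum>z\<in>?U. (norm (\<Sum>i\<in>W. z powi i * f i))\<^sup>2)
      = (\<Sum>z\<in>?U. \<Sum>i\<in>W. \<Sum>j\<in>W. z powi (i - j) * (f i * cnj (f j)))"
    unfolding of_real_sum
  proof (rule sum.cong[OF refl])
    fix z assume "z \<in> ?U"
    then have z: "norm z = 1" using norm_root_unity assms by auto
    then have "z \<noteq> 0" by auto
    show "complex_of_real ((norm (\<Sum>i\<in>W. z powi i * f i))\<^sup>2)
       = (\<Sum>i\<in>W. \<Sum>j\<in>W. z powi (i - j) * (f i * cnj (f j)))"
      unfolding complex_norm_square cnj_sum sum_product
      by (intro sum.cong refl)
         (use \<open>z \<noteq> 0\<close> in \<open>simp add: cnj_eq_inverse[OF z] power_int_inverse power_int_diff field_simps\<close>)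
  qed
  also have "\<dots> = (\<Sum>i\<in>W. \<Sum>z\<in>?U. \<Sum>j\<in>W. z powi (i - j) * (f i * cnj (f j)))"
    by (rule sum.swap)
  also have "\<dots> = (\<Sum>i\<in>W. \<Sum>j\<in>W. \<Sum>z\<in>?U. z powi (i - j) * (f i * cnj (f j)))"
    by (intro sum.cong refl sum.swap)
  also have "\<dots> = (\<Sum>i\<in>W. \<Sum>j\<in>W. if i = j then of_nat N * (f i * cnj (f i)) else 0)"
    by (intro sum.cong refl)
       (auto simp flip: sum_distrib_right simp: sum_roots_unity_powi[OF assms(1)] dest: inj)
  also have "\<dots> = (\<Sum>i\<in>W. of_nat N * (f i * cnj (f i)))"
    using assms(2) by simp
  also have "\<dots> = complex_of_real (of_nat N * (\<Sum>i\<in>W. (norm (f i))\<^sup>2))"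
    by (simp add: sum_distrib_left complex_norm_square del: of_real_power)
  finally show ?thesis
    by (simp only: of_real_eq_iff)
qed

lemma norm_vec_square: "(norm (v :: complex^'n))\<^sup>2 = (\<Sum>r\<in>UNIV. (norm (vec_nth v r))\<^sup>2)"
  by (simp add: norm_vec_def L2_set_def sum_nonneg)

lemma parseval_roots_unity_vec:
  fixes f :: "int \<Rightarrow> complex^'n"
  assumes "N > 0" "finite W" "\<And>i j. i \<in> W \<Longrightarrow> j \<in> W \<Longrightarrow> int N dvd i - j \<Longrightarrow> i = j"
  shows "(\<Sum>z | z ^ N = 1. (norm (\<Sum>i\<in>W. z powi i *s f i))\<^sup>2) = of_nat N * (\<Sum>i\<in>W. (norm (f i))\<^sup>2)"
proof -
  have "(\<Sum>z | z ^ N = 1. (norm (\<Sum>i\<in>W. z powi i *s f i))\<^sup>2)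
     = (\<Sum>r\<in>UNIV. \<Sum>z | z ^ N = 1. (norm (\<Sum>i\<in>W. z powi i * vec_nth (f i) r))\<^sup>2)"
    unfolding norm_vec_square by (subst sum.swap) simp
  also have "\<dots> = (\<Sum>r\<in>UNIV. of_nat N * (\<Sum>i\<in>W. (norm (vec_nth (f i) r))\<^sup>2))"
    by (intro sum.cong refl parseval_roots_unity assms)
  also have "\<dots> = of_nat N * (\<Sum>i\<in>W. \<Sum>r\<in>UNIV. (norm (vec_nth (f i) r))\<^sup>2)"
    unfolding sum_distrib_left[symmetric] by (subst sum.swap) simp
  finally show ?thesis unfolding norm_vec_square .
qed

section \<open>Minkowski's inequality for infinite sums and a lower bound for banded
  convolutions\<close>

lemma has_sum_finite_sum:
  fixes f :: "'z \<Rightarrow> 'k \<Rightarrow> 'a::real_normed_vector"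
  assumes "\<And>z. z \<in> U \<Longrightarrow> (f z has_sum S z) G"
  shows "((\<lambda>k. \<Sum>z\<in>U. f z k) has_sum (\<Sum>z\<in>U. S z)) G"
  using assms by (induction U rule: infinite_finite_induct) (auto intro: has_sum_add)

text \<open>Minkowski's inequality for infinitely many summands: the finite triangle inequality
  passes to the limit along the finite subsets of \<open>G\<close>.\<close>

lemma L2_set_infsum_le:
  fixes f :: "'a \<Rightarrow> 'b \<Rightarrow> real"
  assumes "\<And>i. i \<in> W \<Longrightarrow> (\<lambda>k. f k i) summable_on G"
    and b: "b summable_on G" and le: "\<And>k. k \<in> G \<Longrightarrow> L2_set (f k) W \<le> b k"
  shows "L2_set (\<lambda>i. \<Sum>\<^sub>\<infinity>k\<in>G. f k i) W \<le> (\<Sum>\<^sub>\<infinity>k\<in>G. b k)"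
proof -
  have "L2_set (\<lambda>i. \<Sum>k\<in>F. f k i) W \<le> (\<Sum>k\<in>F. L2_set (f k) W)" for F
  proof (induction F rule: infinite_finite_induct)
    case (insert x F)
    then show ?case
      using L2_set_triangle_ineq[of "f x" "\<lambda>i. \<Sum>k\<in>F. f k i" W] by simp
  qed (simp_all add: L2_set_0')
  moreover have "(\<Sum>k\<in>F. L2_set (f k) W) \<le> sum b F" if "F \<subseteq> G" for F
    using that le by (intro sum_mono) auto
  ultimately have fin: "L2_set (\<lambda>i. \<Sum>k\<in>F. f k i) W \<le> sum b F" if "F \<subseteq> G" for F
    using that order_trans by blast
  show ?thesis
  proof (rule tendsto_le)
    show "(sum b \<longlongrightarrow> (\<Sum>\<^sub>\<infinity>k\<in>G. b k)) (finite_subsets_at_top G)"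
      using b by (rule infsum_tendsto)
    show "((\<lambda>F. L2_set (\<lambda>i. \<Sum>k\<in>F. f k i) W) \<longlongrightarrow> L2_set (\<lambda>i. \<Sum>\<^sub>\<infinity>k\<in>G. f k i) W) (finite_subsets_at_top G)"
      unfolding L2_set_def by (intro tendsto_intros infsum_tendsto assms(1))
    show "\<forall>\<^sub>F F in finite_subsets_at_top G. L2_set (\<lambda>i. \<Sum>k\<in>F. f k i) W \<le> sum b F"
      using fin by (intro eventually_finite_subsets_at_top_weakI) auto
  qed simp
qed

text \<open>On a cyclic group large enough to hold the support of the convolution, the discrete
  Fourier transform turns the convolution into multiplication by the truncated symbol. The bound
  \<open>lower\<close> at each root of unity then carries over to l2 norms by Parseval on both
  sides.\<close>

lemma band_lower_bound:
  fixes D :: "int \<Rightarrow> complex^'n^'n" and y :: "int \<Rightarrow> complex^'n"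
  assumes "K \<ge> 0" "p \<le> q" and supp: "\<And>i. i \<notin> {p..q} \<Longrightarrow> y i = 0"
    and lower: "\<And>z v. norm z = 1 \<Longrightarrow> c * norm v \<le> norm (\<Sum>k\<in>{-K..K}. z powi k *s (D k *v v))"
    and "c \<ge> 0"
  shows "c * L2_set (\<lambda>i. norm (y i)) {p-K..q+K}
       \<le> L2_set (\<lambda>i. norm (\<Sum>k\<in>{-K..K}. D k *v y (i - k))) {p-K..q+K}"
proof -
  define W where "W = {p-K..q+K}"
  \<comment> \<open>This is exactly the number of integers in \<open>W\<close>, so distinct points
    of \<open>W\<close> stay distinct modulo \<open>N\<close> and nothing wraps around.\<close>
  define N where "N = nat (q - p + 2 * K + 1)"
  define g where "g i = (\<Sum>k\<in>{-K..K}. D k *v y (i - k))" for i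
  let ?U = "{z::complex. z ^ N = 1}"
  have "N > 0" "finite W" using assms by (simp_all add: N_def W_def)
  have inj: "i = j" if "i \<in> W" "j \<in> W" "int N dvd i - j" for i j
  proof (rule ccontr)
    assume "i \<noteq> j"
    with that have "int N \<le> \<bar>i - j\<bar>" by (intro dvd_imp_le_int[of "i - j" "int N", simplified]) auto
    then show False using that assms by (auto simp: N_def W_def)
  qed
  have hat: "(\<Sum>i\<in>W. z powi i *s g i)
      = (\<Sum>k\<in>{-K..K}. z powi k *s (D k *v (\<Sum>i\<in>W. z powi i *s y i)))" if "z \<noteq> 0" for z
  proof -
    \<comment> \<open>\<open>W\<close> exceeds the support of \<open>y\<close> by \<open>K\<close>
      on either side, so after a shift by at most \<open>K\<close> it still contains the whole
      support.\<close>
    have shift: "(\<Sum>i\<in>W. z powi (i - k) *s y (i - k)) = (\<Sum>i\<in>W. z powi i *s y i)"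
      if "k \<in> {-K..K}" for k
    proof -
      have "(\<Sum>i\<in>W. z powi (i - k) *s y (i - k)) = (\<Sum>i\<in>{p-K-k..q+K-k}. z powi i *s y i)"
        by (rule sum.reindex_bij_witness[where i = "\<lambda>i. i + k" and j = "\<lambda>i. i - k"]) (auto simp: W_def)
      also have "\<dots> = (\<Sum>i\<in>{p..q}. z powi i *s y i)"
        using that assms by (intro sum.mono_neutral_right) (auto simp: supp)
      also have "\<dots> = (\<Sum>i\<in>W. z powi i *s y i)"
        using assms by (intro sum.mono_neutral_left) (auto simp: W_def supp)
      finally show ?thesis .
    qed
    have "(\<Sum>i\<in>W. z powi i *s g i)
        = (\<Sum>i\<in>W. \<Sum>k\<in>{-K..K}. z powi k *s (D k *v (z powi (i - k) *s y (i - k))))"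
      using that
      by (simp add: g_def matrix_vector_mult_smult linear_sum[OF bounded_linear.linear[OF bounded_linear_vector_smult]]
            vector_smult_assoc flip: power_int_add)
    also have "\<dots> = (\<Sum>k\<in>{-K..K}. \<Sum>i\<in>W. z powi k *s (D k *v (z powi (i - k) *s y (i - k))))"
      by (rule sum.swap)
    also have "\<dots> = (\<Sum>k\<in>{-K..K}. z powi k *s (D k *v (\<Sum>i\<in>W. z powi (i - k) *s y (i - k))))"
      by (simp add: linear_sum[OF bounded_linear.linear[OF bounded_linear_vector_smult]]
           bounded_bilinear.sum_right[OF bounded_bilinear_matrix_vector_mult])
    finally show ?thesis by (simp add: shift)
  qed
  have "of_nat N * (c\<^sup>2 * (\<Sum>i\<in>W. (norm (y i))\<^sup>2))
      = (\<Sum>z\<in>?U. (c * norm (\<Sum>i\<in>W. z powi i *s y i))\<^sup>2)"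
    using parseval_roots_unity_vec[where f = y and W = W, OF \<open>N > 0\<close> _ inj] \<open>finite W\<close>
    by (simp add: power_mult_distrib flip: sum_distrib_left)
  also have "\<dots> \<le> (\<Sum>z\<in>?U. (norm (\<Sum>i\<in>W. z powi i *s g i))\<^sup>2)"
  proof (intro sum_mono power_mono)
    fix z assume "z \<in> ?U"
    then have z: "norm z = 1" using norm_root_unity \<open>N > 0\<close> by auto
    then have "z \<noteq> 0" by auto
    show "c * norm (\<Sum>i\<in>W. z powi i *s y i) \<le> norm (\<Sum>i\<in>W. z powi i *s g i)"
      unfolding hat[OF \<open>z \<noteq> 0\<close>] by (rule lower[OF z])
  qed (use \<open>c \<ge> 0\<close> in auto)
  also have "\<dots> = of_nat N * (\<Sum>i\<in>W. (norm (g i))\<^sup>2)"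
    by (rule parseval_roots_unity_vec[OF \<open>N > 0\<close> \<open>finite W\<close> inj])
  finally have "c\<^sup>2 * (\<Sum>i\<in>W. (norm (y i))\<^sup>2) \<le> (\<Sum>i\<in>W. (norm (g i))\<^sup>2)"
    using \<open>N > 0\<close> by simp
  then have "sqrt (c\<^sup>2 * (\<Sum>i\<in>W. (norm (y i))\<^sup>2)) \<le> sqrt (\<Sum>i\<in>W. (norm (g i))\<^sup>2)"
    by simp
  then show ?thesis
    using \<open>c \<ge> 0\<close> by (simp add: L2_set_def W_def g_def real_sqrt_mult)
qed

section \<open>Laurent operators with summable kernel\<close>

text \<open>A cutoff of slope \<open>1 / R\<close>, whose small slope makes its commutator with a
  banded kernel small, while its support has only about \<open>2 * R\<close> points.\<close>

definition tent :: "int \<Rightarrow> int \<Rightarrow> real" where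
  "tent R i = max 0 (1 - \<bar>real_of_int i\<bar> / real_of_int R)"

lemma tent_nonneg: "0 \<le> tent R i" and tent_le_1: "R > 0 \<Longrightarrow> tent R i \<le> 1" and tent_0 [simp]: "tent R 0 = 1"
  by (auto simp: tent_def)

lemma tent_eq_0: "R > 0 \<Longrightarrow> i \<notin> {-R..R} \<Longrightarrow> tent R i = 0"
  by (auto simp: tent_def max_def field_simps)

lemma tent_lipschitz: "R > 0 \<Longrightarrow> \<bar>tent R i - tent R j\<bar> \<le> \<bar>real_of_int (i - j)\<bar> / real_of_int R"
proof -
  assume "R > 0"
  have "\<bar>tent R i - tent R j\<bar> \<le> \<bar>\<bar>real_of_int i\<bar> / real_of_int R - \<bar>real_of_int j\<bar> / real_of_int R\<bar>"
    unfolding tent_def by linarith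
  also have "\<dots> = \<bar>\<bar>real_of_int i\<bar> - \<bar>real_of_int j\<bar>\<bar> / real_of_int R"
    using \<open>R > 0\<close> by (simp flip: diff_divide_distrib)
  also have "\<dots> \<le> \<bar>real_of_int (i - j)\<bar> / real_of_int R"
    using \<open>R > 0\<close> by (intro divide_right_mono) auto
  finally show ?thesis .
qed

text \<open>The matrix-valued symbol of the Laurent operator, given through its action on a vector
  so that only sums in \<open>complex^2\<close> have to converge.\<close>

definition symbol :: "(int \<Rightarrow> complex^2^2) \<Rightarrow> complex \<Rightarrow> complex^2 \<Rightarrow> complex^2" where
  "symbol D z v = (\<Sum>\<^sub>\<infinity>k. z powi k *s (D k *v v))"

text \<open>\<open>B k\<close> dominates the operator norm of the block \<open>D k\<close>. Keeping
  the majorant abstract allows the theory to be applied also to the kernel of the operator minus a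
  scalar.\<close>

locale summable_kernel =
  fixes D :: "int \<Rightarrow> complex^2^2" and B :: "int \<Rightarrow> real"
  assumes norm_le: "norm (D k *v x) \<le> B k * norm x" and summable_B: "B summable_on UNIV"
begin

lemma B_nonneg: "B k \<ge> 0"
proof -
  have "0 \<le> B k * norm (1 :: complex^2)"
    using norm_le[of k 1] norm_ge_zero order_trans by blast
  then show ?thesis by (simp add: zero_le_mult_iff)
qed

lemma summable_B_on: "B summable_on G"
  using summable_B summable_on_subset_banach by blast

lemma norm_term_le: "norm v \<le> X \<Longrightarrow> norm (D k *v v) \<le> B k * X"
  using norm_le[of k v] mult_left_mono[OF _ B_nonneg, of "norm v" X k] by linarith

lemma conv_summable:
  assumes "\<And>j. norm (x j) \<le> X"
  shows "(\<lambda>k. D k *v x (i - k)) summable_on G"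
proof -
  have "(\<lambda>k. norm (D k *v x (i - k))) summable_on G"
    using summable_on_cmult_left[OF summable_B_on, of X]
    by (rule Infinite_Sum.abs_summable_on_comparison_test') (simp add: norm_term_le assms)
  then show ?thesis by (rule abs_summable_summable)
qed

lemma norm_conv_le:
  assumes "\<And>j. norm (x j) \<le> X"
  shows "norm (\<Sum>\<^sub>\<infinity>k\<in>G. D k *v x (i - k)) \<le> infsum B G * X"
proof (rule norm_infsum_le)
  show "((\<lambda>k. D k *v x (i - k)) has_sum (\<Sum>\<^sub>\<infinity>k\<in>G. D k *v x (i - k))) G"
    by (intro has_sum_infsum conv_summable[of x X] assms)
  show "((\<lambda>k. B k * X) has_sum infsum B G * X) G"
    by (intro has_sum_cmult_left has_sum_infsum summable_B_on)
qed (simp add: norm_term_le assms)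

lemma laurent_op_conv: "laurent_op D x i = (\<Sum>\<^sub>\<infinity>k. D k *v x (i - k))"
  unfolding laurent_op_def
  by (rule infsum_reindex_bij_witness[where i = "\<lambda>k. i - k" and j = "\<lambda>k. i - k"]) auto

lemma laurent_op_linf:
  assumes "x \<in> linf"
  shows "laurent_op D x \<in> linf"
proof -
  obtain X where "\<And>j. norm (x j) \<le> X"
    using assms by (auto simp: linf_def bounded_iff)
  then show ?thesis
    unfolding linf_def mem_Collect_eq bounded_iff laurent_op_conv using norm_conv_le by blast
qed

lemma symbol_term_le: "norm z = 1 \<Longrightarrow> norm (z powi k *s (D k *v v)) \<le> B k * norm v"
  using norm_le by (simp add: norm_vector_smult norm_power_int)

lemma symbol_summable:
  assumes "norm z = 1"
  shows "(\<lambda>k. z powi k *s (D k *v v)) summable_on G"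
proof -
  have "(\<lambda>k. norm (z powi k *s (D k *v v))) summable_on G"
    using summable_on_cmult_left[OF summable_B_on, of "norm v"]
    by (rule Infinite_Sum.abs_summable_on_comparison_test') (use symbol_term_le assms in auto)
  then show ?thesis by (rule abs_summable_summable)
qed

lemma symbol_tail_le:
  assumes "norm z = 1"
  shows "norm (\<Sum>\<^sub>\<infinity>k\<in>G. z powi k *s (D k *v v)) \<le> infsum B G * norm v"
proof (rule norm_infsum_le)
  show "((\<lambda>k. z powi k *s (D k *v v)) has_sum (\<Sum>\<^sub>\<infinity>k\<in>G. z powi k *s (D k *v v))) G"
    by (intro has_sum_infsum symbol_summable assms)
  show "((\<lambda>k. B k * norm v) has_sum infsum B G * norm v) G"
    by (intro has_sum_cmult_left has_sum_infsum summable_B_on)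
qed (use symbol_term_le assms in auto)

text \<open>With the exponent \<open>-j\<close>, replacing \<open>j\<close> by \<open>i - k\<close>
  produces the factor \<open>z powi k\<close> of the symbol. An eigenvector of the symbol at
  \<open>z\<close> thus yields a bounded eigenvector of the operator.\<close>

lemma laurent_op_exponential:
  assumes "norm z = 1"
  shows "laurent_op D (\<lambda>j. z powi (-j) *s v) i = z powi (-i) *s symbol D z v"
proof -
  have "z \<noteq> 0" using assms by auto
  have "laurent_op D (\<lambda>j. z powi (-j) *s v) i = (\<Sum>\<^sub>\<infinity>k. z powi (-i) *s (z powi k *s (D k *v v)))"
    unfolding laurent_op_conv using \<open>z \<noteq> 0\<close>
    by (intro infsum_cong)
       (simp add: matrix_vector_mult_smult vector_smult_assoc flip: power_int_add)
  also have "\<dots> = z powi (-i) *s symbol D z v"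
    unfolding symbol_def
    by (intro infsumI has_sum_bounded_linear[OF bounded_linear_vector_smult] has_sum_infsum
         symbol_summable assms)
  finally show ?thesis .
qed

lemma small_tail:
  assumes "\<epsilon> > 0"
  obtains K :: int where "K \<ge> 1" "infsum B (UNIV - {-K..K}) \<le> \<epsilon>"
proof -
  obtain F where F: "finite F" "dist (sum B F) (infsum B UNIV) \<le> \<epsilon>"
    using infsum_finite_approximation[OF summable_B assms] by blast
  \<comment> \<open>A crude bound for all absolute values in \<open>F\<close>; the summand 1 ensures
    \<open>K \<ge> 1\<close>.\<close>
  define K where "K = 1 + (\<Sum>k\<in>F. \<bar>k\<bar>)"
  have "\<bar>k\<bar> \<le> K" if "k \<in> F" for k
    unfolding K_def using member_le_sum[OF that, of abs] F(1) by simp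
  then have "F \<subseteq> {-K..K}" by (fastforce simp: abs_le_iff)
  then have "sum B F \<le> sum B {-K..K}"
    by (intro sum_mono2 B_nonneg) auto
  moreover have "infsum B (UNIV - {-K..K}) = infsum B UNIV - sum B {-K..K}"
    by (subst infsum_Diff) (auto intro: summable_B)
  ultimately have "infsum B (UNIV - {-K..K}) \<le> \<epsilon>"
    using F(2) by (simp add: dist_real_def)
  moreover have "K \<ge> 1" by (simp add: K_def sum_nonneg)
  ultimately show ?thesis using that by blast
qed

lemma infsum_split_band:
  fixes f :: "int \<Rightarrow> complex^2"
  assumes "f summable_on UNIV"
  shows "infsum f UNIV = sum f {-K..K} + infsum f (UNIV - {-K..K})"
  using infsum_Diff[OF assms, of "{-K..K}"] by simp

section \<open>Localization: the lower bound in the sup norm\<close>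

text \<open>Let \<open>N\<close> be the supremum of the local l2 norms \<open>E m\<close> of
  \<open>x\<close> cut off by a tent around \<open>m\<close>. The band estimate bounds
  \<open>3 * c / 4 * E m\<close> by \<open>w * s\<close> from the values of the operator, plus
  \<open>c / 4 * N\<close> from the tail of the kernel, plus \<open>c / 4 * N\<close> from the
  commutator with the tent. Taking the supremum and absorbing leaves
  \<open>N \<le> 4 / c * w * s\<close>, and \<open>N\<close> dominates the sup norm of
  \<open>x\<close>.\<close>

lemma laurent_op_bounded_below:
  assumes "c > 0" and sym: "\<And>z v. norm z = 1 \<Longrightarrow> c * norm v \<le> norm (symbol D z v)"
  obtains C where "C > 0"
    "\<And>x s i. x \<in> linf \<Longrightarrow> (\<And>j. norm (laurent_op D x j) \<le> s) \<Longrightarrow> norm (x i) \<le> C * s"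
proof -
  obtain K where K: "K \<ge> 1" "infsum B (UNIV - {-K..K}) \<le> c / 4"
    using small_tail[of "c / 4"] \<open>c > 0\<close> by auto
  define S where "S = sum B {-K..K}"
  have "S \<ge> 0" unfolding S_def by (intro sum_nonneg B_nonneg)
  \<comment> \<open>Cutting the tail off the symbol costs at most \<open>c / 4\<close> of the lower
    bound \<open>c\<close>.\<close>
  have band: "3 * c / 4 * norm v \<le> norm (\<Sum>k\<in>{-K..K}. z powi k *s (D k *v v))" if "norm z = 1" for z v
  proof -
    have "symbol D z v = (\<Sum>k\<in>{-K..K}. z powi k *s (D k *v v))
        + (\<Sum>\<^sub>\<infinity>k\<in>UNIV - {-K..K}. z powi k *s (D k *v v))"
      unfolding symbol_def by (intro infsum_split_band symbol_summable that)
    moreover have "norm (\<Sum>\<^sub>\<infinity>k\<in>UNIV - {-K..K}. z powi k *s (D k *v v)) \<le> c / 4 * norm v"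
      using symbol_tail_le[OF that] K(2) by (meson mult_right_mono norm_ge_zero order_trans)
    ultimately show ?thesis
      using sym[OF that, of v] norm_triangle_ineq[of "\<Sum>k\<in>{-K..K}. z powi k *s (D k *v v)"
          "\<Sum>\<^sub>\<infinity>k\<in>UNIV - {-K..K}. z powi k *s (D k *v v)"]
      by (simp add: algebra_simps)
  qed
  \<comment> \<open>The left-hand side is the l2 norm over a window of the pointwise commutator
    bound. It is of order \<open>sqrt R / R\<close>, so a wide tent makes it small.\<close>
  obtain R :: int where R: "R > 0"
    "sqrt (2 * (real_of_int R + K) + 1) * (K / real_of_int R * S) \<le> c / 4"
  proof -
    have "((\<lambda>n::nat. sqrt (2 * (real n + K) + 1) / real n) \<longlonglongrightarrow> 0)"
      by real_asymp
    from tendsto_mult_left_zero[OF this, of "real_of_int K * S"]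
    have "\<forall>\<^sub>F n::nat in sequentially. sqrt (2 * (real n + K) + 1) / real n * (K * S) < c / 4"
      using \<open>c > 0\<close> by (intro order_tendstoD) auto
    then have "\<forall>\<^sub>F n::nat in sequentially. n > 0 \<and> sqrt (2 * (real n + K) + 1) / real n * (K * S) < c / 4"
      using eventually_gt_at_top[of 0] by eventually_elim auto
    then obtain n :: nat where "n > 0" "sqrt (2 * (real n + K) + 1) / real n * (K * S) < c / 4"
      by (auto simp: eventually_sequentially)
    then show ?thesis by (intro that[of "int n"]) (auto simp: field_simps)
  qed
  define \<phi> where "\<phi> = tent R"
  define W where "W m = {m-R-K..m+R+K}" for m :: int
  \<comment> \<open>The l2 norm of the constant 1 over any window \<open>W m\<close>, which has
    \<open>2 * (R + K) + 1\<close> points.\<close>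
  define w where "w = sqrt (2 * (real_of_int R + K) + 1)"
  have "w > 0" unfolding w_def using R(1) K(1) by auto
  have const: "L2_set (\<lambda>i. t) (W m) = w * t" if "t \<ge> 0" for t m
    using that R(1) K(1) by (simp add: L2_set_constant W_def w_def algebra_simps)
  note \<phi>0 = tent_nonneg[of R, folded \<phi>_def] and \<phi>1 = tent_le_1[OF R(1), folded \<phi>_def]
  have bound: "norm (x i) \<le> 4 / c * w * s"
    if "x \<in> linf" and s: "\<And>j. norm (laurent_op D x j) \<le> s" for x s i
  proof -
    obtain X where X: "\<And>j. norm (x j) \<le> X"
      using \<open>x \<in> linf\<close> by (auto simp: linf_def bounded_iff)
    have "X \<ge> 0" using X[of 0] norm_ge_zero order_trans by blast
    have "s \<ge> 0" using s[of 0] norm_ge_zero order_trans by blast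
    define E where "E m = L2_set (\<lambda>i. \<phi> (i - m) * norm (x i)) (W m)" for m
    \<comment> \<open>The supremum is finite because \<open>x\<close> is bounded; without this the
      final absorption would be meaningless.\<close>
    define N where "N = (SUP m. E m)"
    have "E m \<le> w * X" for m
    proof -
      have "E m \<le> L2_set (\<lambda>i. X) (W m)"
        unfolding E_def using X mult_mono[OF \<phi>1 X] by (intro L2_set_mono) (auto simp: \<phi>0)
      then show ?thesis using const \<open>X \<ge> 0\<close> by simp
    qed
    then have bdd: "bdd_above (range E)" by (rule bdd_aboveI2)
    have EN: "E m \<le> N" for m unfolding N_def by (intro cSUP_upper bdd) simp
    \<comment> \<open>The tent equals 1 at its centre, so a single term of \<open>E j\<close>
      already gives the size of \<open>x j\<close>.\<close>
    have xN: "norm (x j) \<le> N" for j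
    proof -
      have "norm (x j) = \<phi> (j - j) * norm (x j)" by (simp add: \<phi>_def)
      also have "\<dots> \<le> E j"
        unfolding E_def using R(1) K(1)
        by (intro member_le_L2_set[where f = "\<lambda>i. \<phi> (i - j) * norm (x i)"]) (auto simp: W_def)
      also have "\<dots> \<le> N" by (rule EN)
      finally show ?thesis .
    qed
    have "N \<ge> 0" using xN[of 0] norm_ge_zero order_trans by blast
    have step: "3 * c / 4 * E m \<le> w * s + c / 4 * N + c / 4 * N" for m
    proof -
      define y where "y i = \<phi> (i - m) *\<^sub>R x i" for i
      define g where "g i = (\<Sum>k\<in>{-K..K}. D k *v y (i - k))" for i
      \<comment> \<open>The tail is kept as a sum over \<open>k\<close>. Bounding it pointwise by
        \<open>N\<close> would cost a factor \<open>w\<close> in the l2 norm, whereas Minkowski's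
        inequality below avoids this factor.\<close>
      define far where "far i = (\<Sum>\<^sub>\<infinity>k\<in>UNIV - {-K..K}. \<phi> (i - m) * norm (x (i - k)) * B k)" for i
      have Ey: "E m = L2_set (\<lambda>i. norm (y i)) (W m)"
        unfolding E_def y_def by (intro L2_set_cong) (auto simp: \<phi>0)
      have lower: "3 * c / 4 * E m \<le> L2_set (\<lambda>i. norm (g i)) (W m)"
        unfolding Ey g_def W_def
      proof (rule band_lower_bound)
        show "y i = 0" if "i \<notin> {m - R..m + R}" for i
          using that tent_eq_0[OF R(1), of "i - m"] by (auto simp: y_def \<phi>_def)
      qed (use K(1) R(1) \<open>c > 0\<close> band in auto)
      have farsum: "(\<lambda>k. \<phi> (i - m) * norm (x (i - k)) * B k) summable_on (UNIV - {-K..K})" for i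
        by (rule summable_on_comparison_test[OF summable_on_cmult_right[OF summable_B_on, of X]])
           (auto intro!: mult_right_mono B_nonneg mult_nonneg_nonneg
              order_trans[OF mult_right_mono[OF \<phi>1]] simp: \<phi>0 X)
      have g_le: "norm (g i) \<le> s + far i + K / R * S * N" for i
      proof -
        have split: "laurent_op D x i = (\<Sum>k\<in>{-K..K}. D k *v x (i - k))
             + (\<Sum>\<^sub>\<infinity>k\<in>UNIV - {-K..K}. D k *v x (i - k))"
          unfolding laurent_op_conv by (intro infsum_split_band conv_summable[OF X])
        \<comment> \<open>The tent is moved out of the convolution: its value at
          \<open>i - k - m\<close> is the value at \<open>i - m\<close> plus a difference, and the
          differences form the commutator.\<close>
        have "g i = (\<Sum>k\<in>{-K..K}. \<phi> (i - m) *\<^sub>R (D k *v x (i - k))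
              + (\<phi> (i - k - m) - \<phi> (i - m)) *\<^sub>R (D k *v x (i - k)))"
          unfolding g_def y_def
          by (intro sum.cong refl)
             (simp add: bounded_bilinear.scaleR_right[OF bounded_bilinear_matrix_vector_mult]
               flip: scaleR_add_left)
        also have "\<dots> = \<phi> (i - m) *\<^sub>R laurent_op D x i
              - \<phi> (i - m) *\<^sub>R (\<Sum>\<^sub>\<infinity>k\<in>UNIV - {-K..K}. D k *v x (i - k))
              + (\<Sum>k\<in>{-K..K}. (\<phi> (i - k - m) - \<phi> (i - m)) *\<^sub>R (D k *v x (i - k)))"
          by (simp add: split sum.distrib scaleR_add_right scaleR_sum_right)
        finally have g: "g i = \<dots>" .
        have 1: "norm (\<phi> (i - m) *\<^sub>R laurent_op D x i) \<le> s"
          using mult_mono[OF \<phi>1 s[of i], of "i - m"] by (simp add: \<phi>0)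
        have 2: "norm (\<phi> (i - m) *\<^sub>R (\<Sum>\<^sub>\<infinity>k\<in>UNIV - {-K..K}. D k *v x (i - k))) \<le> far i"
          unfolding far_def
        proof (rule norm_infsum_le[where f = "\<lambda>k. \<phi> (i - m) *\<^sub>R (D k *v x (i - k))"
              and g = "\<lambda>k. \<phi> (i - m) * norm (x (i - k)) * B k" and X = "UNIV - {-K..K}"])
          show "((\<lambda>k. \<phi> (i - m) *\<^sub>R (D k *v x (i - k))) has_sum
                \<phi> (i - m) *\<^sub>R (\<Sum>\<^sub>\<infinity>k\<in>UNIV - {-K..K}. D k *v x (i - k))) (UNIV - {-K..K})"
            by (intro has_sum_bounded_linear[OF bounded_linear_scaleR_right] has_sum_infsum conv_summable[OF X])
          show "norm (\<phi> (i - m) *\<^sub>R (D k *v x (i - k))) \<le> \<phi> (i - m) * norm (x (i - k)) * B k" for k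
            using mult_left_mono[OF norm_le[of k "x (i - k)"] \<phi>0[of "i - m"]]
            by (simp add: \<phi>0 mult_ac)
        qed (intro has_sum_infsum farsum)
        have 3: "norm (\<Sum>k\<in>{-K..K}. (\<phi> (i - k - m) - \<phi> (i - m)) *\<^sub>R (D k *v x (i - k))) \<le> K / R * S * N"
        proof -
          have "norm (\<Sum>k\<in>{-K..K}. (\<phi> (i - k - m) - \<phi> (i - m)) *\<^sub>R (D k *v x (i - k)))
             \<le> (\<Sum>k\<in>{-K..K}. K / R * (B k * N))"
          proof (rule sum_norm_le)
            fix k assume k: "k \<in> {-K..K}"
            have "\<bar>\<phi> (i - k - m) - \<phi> (i - m)\<bar> \<le> \<bar>real_of_int (i - k - m - (i - m))\<bar> / R"
              unfolding \<phi>_def by (rule tent_lipschitz[OF R(1)])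
            also have "\<dots> \<le> K / R"
              using k R(1) by (intro divide_right_mono) auto
            finally show "norm ((\<phi> (i - k - m) - \<phi> (i - m)) *\<^sub>R (D k *v x (i - k))) \<le> K / R * (B k * N)"
              using norm_term_le[OF xN, of k "i - k"] K(1) R(1)
              unfolding norm_scaleR real_norm_def by (intro mult_mono) auto
          qed
          then show ?thesis by (simp add: S_def sum_distrib_left sum_distrib_right mult_ac)
        qed
        have "norm (p - q + r) \<le> norm p + norm q + norm r" for p q r :: "complex^2"
          by norm
        then show ?thesis
          unfolding g using 1 2 3 by (smt (verit))
      qed
      have far_le: "L2_set far (W m) \<le> c / 4 * N"
      proof -
        have "L2_set far (W m) \<le> (\<Sum>\<^sub>\<infinity>k\<in>UNIV - {-K..K}. N * B k)"
          unfolding far_def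
        proof (rule L2_set_infsum_le[OF farsum])
          show "(\<lambda>k. N * B k) summable_on (UNIV - {-K..K})"
            by (intro summable_on_cmult_right summable_B_on)
          fix k
          \<comment> \<open>Translating \<open>x\<close> by \<open>k\<close> turns the local norm
            around \<open>m\<close> into the one around \<open>m - k\<close>. This is why the
            supremum is taken over all centres.\<close>
          have "L2_set (\<lambda>i. \<phi> (i - m) * norm (x (i - k))) (W m) = E (m - k)"
            unfolding E_def L2_set_def
            by (rule arg_cong[where f = sqrt],
                rule sum.reindex_bij_witness[where i = "\<lambda>i. i + k" and j = "\<lambda>i. i - k"])
               (auto simp: W_def algebra_simps)
          then show "L2_set (\<lambda>i. \<phi> (i - m) * norm (x (i - k)) * B k) (W m) \<le> N * B k"
            using mult_right_mono[OF EN[of "m - k"] B_nonneg[of k]] L2_set_left_distrib[OF B_nonneg[of k]]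
            by metis
        qed
        also have "\<dots> = infsum B (UNIV - {-K..K}) * N"
          by (subst infsum_cmult_right) (auto intro: summable_B_on)
        also have "\<dots> \<le> c / 4 * N"
          using K(2) \<open>N \<ge> 0\<close> by (rule mult_right_mono)
        finally show ?thesis .
      qed
      have "K / R * S * N \<ge> 0" using K(1) R(1) \<open>S \<ge> 0\<close> \<open>N \<ge> 0\<close> by simp
      have "L2_set (\<lambda>i. norm (g i)) (W m) \<le> L2_set (\<lambda>i. s + far i + K / R * S * N) (W m)"
        by (intro L2_set_mono g_le) auto
      also have "\<dots> \<le> L2_set (\<lambda>i. s) (W m) + L2_set far (W m) + L2_set (\<lambda>i. K / R * S * N) (W m)"
        using L2_set_triangle_ineq[of "\<lambda>i. s + far i" "\<lambda>i. K / R * S * N" "W m"]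
              L2_set_triangle_ineq[of "\<lambda>i. s" far "W m"] by linarith
      also have "\<dots> \<le> w * s + c / 4 * N + c / 4 * N"
      proof -
        have "w * (K / R * S) * N \<le> c / 4 * N"
          using R(2) \<open>N \<ge> 0\<close> unfolding w_def by (intro mult_right_mono)
        then have "w * (K / R * S * N) \<le> c / 4 * N"
          by (simp only: mult.assoc)
        then show ?thesis
          using far_le const[OF \<open>s \<ge> 0\<close>, of m] const[OF \<open>K / R * S * N \<ge> 0\<close>, of m]
          by linarith
      qed
      finally show ?thesis using lower by linarith
    qed
    have "3 * c / 4 * N \<le> w * s + c / 4 * N + c / 4 * N"
    proof -
      have "(SUP m. E m) \<le> (w * s + c / 4 * N + c / 4 * N) / (3 * c / 4)"
      proof (rule cSUP_least)
        show "E m \<le> (w * s + c / 4 * N + c / 4 * N) / (3 * c / 4)" for m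
          using step[of m] \<open>c > 0\<close> by (subst pos_le_divide_eq) (auto simp: mult.commute)
      qed simp
      then show ?thesis using \<open>c > 0\<close> by (simp add: field_simps flip: N_def)
    qed
    then have "N \<le> 4 / c * w * s" using \<open>c > 0\<close> by (simp add: field_simps)
    then show ?thesis using xN[of i] by linarith
  qed
  show ?thesis
    by (rule that[of "4 / c * w"]) (use bound \<open>c > 0\<close> \<open>w > 0\<close> in auto)
qed

section \<open>Linearity and continuity of the operator and of its symbol\<close>

lemma conv_has_sum:
  assumes "x \<in> linf"
  shows "((\<lambda>k. D k *v x (i - k)) has_sum laurent_op D x i) UNIV"
proof -
  obtain X where "\<And>j. norm (x j) \<le> X"
    using assms by (auto simp: linf_def bounded_iff)
  then show ?thesis
    unfolding laurent_op_conv by (intro has_sum_infsum conv_summable)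
qed

lemma laurent_op_sum:
  assumes "\<And>z. z \<in> U \<Longrightarrow> f z \<in> linf"
  shows "laurent_op D (\<lambda>j. \<Sum>z\<in>U. f z j) i = (\<Sum>z\<in>U. laurent_op D (f z) i)"
  unfolding laurent_op_conv[of "\<lambda>j. \<Sum>z\<in>U. f z j"]
    bounded_bilinear.sum_right[OF bounded_bilinear_matrix_vector_mult]
  by (intro infsumI has_sum_finite_sum conv_has_sum assms)

lemma laurent_op_diff:
  assumes "x \<in> linf" "y \<in> linf"
  shows "laurent_op D (\<lambda>j. x j - y j) i = laurent_op D x i - laurent_op D y i"
proof -
  have "((\<lambda>k. D k *v x (i - k) + - (D k *v y (i - k))) has_sum (laurent_op D x i + - laurent_op D y i)) UNIV"
    using conv_has_sum[OF assms(2)]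
    by (intro has_sum_add conv_has_sum assms) (simp add: has_sum_uminus)
  then show ?thesis
    unfolding laurent_op_conv[of "\<lambda>j. x j - y j"]
    by (simp add: bounded_bilinear.diff_right[OF bounded_bilinear_matrix_vector_mult] infsumI)
qed

lemma linf_diff:
  assumes "x \<in> linf" "y \<in> linf"
  shows "(\<lambda>j. x j - y j) \<in> linf"
  using assms bounded_minus_comp[of x UNIV y] by (simp add: linf_def)

text \<open>Dominated convergence: the summable majorant \<open>B k * X\<close> makes the
  convolution sums converge uniformly in \<open>n\<close>, so the two limits may be
  interchanged.\<close>

lemma laurent_op_tendsto:
  assumes X: "\<And>n j. norm (xs n j) \<le> X" and lim: "\<And>j. (\<lambda>n. xs n j) \<longlonglongrightarrow> x j"
  shows "(\<lambda>n. laurent_op D (xs n) i) \<longlonglongrightarrow> laurent_op D x i"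
proof -
  have xX: "norm (x j) \<le> X" for j
    using tendsto_norm[OF lim[of j]] X by (intro LIMSEQ_le_const2[of "\<lambda>n. norm (xs n j)"]) auto
  show ?thesis
    unfolding laurent_op_conv
  proof (rule swap_uniform_limit'[where F = "finite_subsets_at_top UNIV"])
    show "\<forall>\<^sub>F F in finite_subsets_at_top UNIV.
       (\<lambda>n. \<Sum>k\<in>F. D k *v xs n (i - k)) \<longlonglongrightarrow> (\<Sum>k\<in>F. D k *v x (i - k))"
      by (intro always_eventually allI tendsto_sum
           bounded_bilinear.tendsto[OF bounded_bilinear_matrix_vector_mult] tendsto_const lim)
    show "((\<lambda>F. \<Sum>k\<in>F. D k *v x (i - k)) \<longlongrightarrow> (\<Sum>\<^sub>\<infinity>k. D k *v x (i - k))) (finite_subsets_at_top UNIV)"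
      by (intro infsum_tendsto conv_summable[OF xX])
    show "uniform_limit UNIV (\<lambda>F n. \<Sum>k\<in>F. D k *v xs n (i - k)) (\<lambda>n. \<Sum>\<^sub>\<infinity>k. D k *v xs n (i - k))
       (finite_subsets_at_top UNIV)"
      by (rule Weierstrass_m_test_general[OF _ summable_on_cmult_left[OF summable_B]])
         (rule norm_term_le[OF X])
  qed auto
qed

lemma symbol_has_sum:
  assumes "norm z = 1"
  shows "((\<lambda>k. z powi k *s (D k *v v)) has_sum symbol D z v) UNIV"
  unfolding symbol_def by (intro has_sum_infsum symbol_summable assms)

lemma symbol_smult:
  assumes "norm z = 1"
  shows "symbol D z (c *s v) = c *s symbol D z v"
proof -
  have "z powi k *s (D k *v (c *s v)) = c *s (z powi k *s (D k *v v))" for k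
    by (simp add: matrix_vector_mult_smult vector_smult_assoc mult.commute)
  then show ?thesis
    unfolding symbol_def[of D z "c *s v"]
    using has_sum_bounded_linear[OF bounded_linear_vector_smult symbol_has_sum[OF assms]]
    by (simp add: infsumI)
qed

lemma linear_symbol:
  assumes "norm z = 1"
  shows "linear (symbol D z)"
proof (rule linearI)
  show "symbol D z (v + w) = symbol D z v + symbol D z w" for v w
    unfolding symbol_def[of D z "v + w"] matrix_vector_right_distrib vector_add_ldistrib
    by (intro infsumI has_sum_add symbol_has_sum assms)
  show "symbol D z (r *\<^sub>R v) = r *\<^sub>R symbol D z v" for r v
    using symbol_smult[OF assms, of "of_real r" v]
    by (simp add: scaleR_conv_of_real Finite_Cartesian_Product.vec_eq_iff
         vector_scalar_mult_def scaleR_vec_def)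
qed

text \<open>On the product of the unit spheres the terms are dominated by \<open>B k\<close>, so the
  Weierstrass test applies. Continuity is joint in \<open>z\<close> and \<open>v\<close> because the
  next compactness argument minimizes over both.\<close>

lemma continuous_on_symbol:
  "continuous_on (sphere 0 1 \<times> sphere 0 1) (\<lambda>(z, v). symbol D z v)"
proof (rule uniform_limit_theorem)
  show "\<forall>\<^sub>F F in finite_subsets_at_top UNIV.
      continuous_on (sphere 0 1 \<times> sphere 0 1) (\<lambda>p. \<Sum>k\<in>F. fst p powi k *s (D k *v snd p))"
    by (intro always_eventually allI continuous_on_sum
         bounded_bilinear.continuous_on[OF bounded_bilinear_vector_smult]
         bounded_bilinear.continuous_on[OF bounded_bilinear_matrix_vector_mult] continuous_intros) auto
  show "uniform_limit (sphere 0 1 \<times> sphere 0 1) (\<lambda>F p. \<Sum>k\<in>F. fst p powi k *s (D k *v snd p))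
     (\<lambda>(z, v). symbol D z v) (finite_subsets_at_top UNIV)"
    unfolding symbol_def case_prod_beta
  proof (rule Weierstrass_m_test_general[OF _ summable_B])
    show "norm (fst p powi k *s (D k *v snd p)) \<le> B k" if "p \<in> sphere 0 1 \<times> sphere 0 1" for k p
      using symbol_term_le[of "fst p" k "snd p"] that by (auto simp: mem_Times_iff)
  qed
qed simp

text \<open>The norm of the symbol attains a positive minimum on the compact product of unit
  spheres, and homogeneity in \<open>v\<close> extends the bound to all vectors.\<close>

lemma symbol_lower_bound:
  assumes inj: "\<And>z v. norm z = 1 \<Longrightarrow> v \<noteq> 0 \<Longrightarrow> symbol D z v \<noteq> 0"
  obtains c where "c > 0" "\<And>z v. norm z = 1 \<Longrightarrow> c * norm v \<le> norm (symbol D z v)"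
proof -
  let ?S = "sphere 0 1 \<times> sphere 0 1 :: (complex \<times> (complex^2)) set"
  have "compact ?S" by (intro compact_Times compact_sphere)
  moreover have "?S \<noteq> {}" by simp
  moreover have "continuous_on ?S (\<lambda>p. norm (case p of (z, v) \<Rightarrow> symbol D z v))"
    by (intro continuous_on_norm continuous_on_symbol)
  ultimately obtain p where p: "p \<in> ?S"
    "\<And>q. q \<in> ?S \<Longrightarrow> norm (case p of (z, v) \<Rightarrow> symbol D z v) \<le> norm (case q of (z, v) \<Rightarrow> symbol D z v)"
    using continuous_attains_inf by metis
  define c where "c = norm (case p of (z, v) \<Rightarrow> symbol D z v)"
  have "c > 0"
  proof -
    obtain z v where "p = (z, v)" by (cases p)
    with p(1) have "norm z = 1" "v \<noteq> 0" by auto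
    from inj[OF this] show ?thesis by (simp add: c_def \<open>p = (z, v)\<close>)
  qed
  moreover have "c * norm v \<le> norm (symbol D z v)" if z: "norm z = 1" for z v
  proof (cases "v = 0")
    case False
    define t where "t = complex_of_real (norm v)"
    have t: "t \<noteq> 0" "norm t = norm v" using False by (auto simp: t_def)
    have "norm (inverse t *s v) = 1"
      using t False by (simp add: norm_vector_smult norm_inverse)
    then have "c \<le> norm (symbol D z (inverse t *s v))"
      using p(2)[of "(z, inverse t *s v)"] z by (simp add: c_def)
    also have "\<dots> = norm (symbol D z v) / norm v"
      using t by (simp add: symbol_smult[OF z] norm_vector_smult norm_inverse divide_inverse_commute)
    finally show ?thesis using False by (simp add: field_simps)
  qed simp
  ultimately show ?thesis by (rule that)
qed

lemma linf_exponential: "norm z = 1 \<Longrightarrow> (\<lambda>j. z powi (-j) *s v) \<in> linf"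
  unfolding linf_def mem_Collect_eq bounded_iff
  by (intro exI[of _ "norm v"]) (auto simp: norm_vector_smult norm_power_int)

section \<open>Invertibility on bounded sequences and the spectrum of the Laurent operator\<close>

text \<open>Restricting \<open>b\<close> to \<open>W n\<close> and extending it periodically gives a
  finite combination of exponentials, for which the equation is solved by inverting the symbol at
  each root of unity. The sup norm lower bound keeps these solutions uniformly bounded, so a
  subsequence converges pointwise, and the limit solves the equation for \<open>b\<close>.\<close>

lemma laurent_op_surj:
  assumes inj: "\<And>z v. norm z = 1 \<Longrightarrow> v \<noteq> 0 \<Longrightarrow> symbol D z v \<noteq> 0" and "b \<in> linf"
  obtains x where "x \<in> linf" "laurent_op D x = b"
proof -
  obtain c where c: "c > 0" "\<And>z v. norm z = 1 \<Longrightarrow> c * norm v \<le> norm (symbol D z v)"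
    using symbol_lower_bound[OF inj] by blast
  obtain C where C: "C > 0"
    "\<And>x s i. x \<in> linf \<Longrightarrow> (\<And>j. norm (laurent_op D x j) \<le> s) \<Longrightarrow> norm (x i) \<le> C * s"
    using laurent_op_bounded_below[OF c] by blast
  obtain s where s: "\<And>j. norm (b j) \<le> s"
    using \<open>b \<in> linf\<close> by (auto simp: linf_def bounded_iff)
  have "s \<ge> 0" using s[of 0] norm_ge_zero order_trans by blast
  have "\<exists>v. symbol D z v = w" if "norm z = 1" for z w
  proof -
    \<comment> \<open>Real linearity suffices here, since \<open>complex^2\<close> has finite
      dimension over the reals.\<close>
    have "inj (symbol D z)"
      using linear_injective_0[OF linear_symbol[OF that]] inj[OF that] by blast
    then have "surj (symbol D z)"
      by (intro linear_injective_imp_surjective linear_symbol that) simp_all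
    then show ?thesis by (metis surjD)
  qed
  then obtain G where G: "\<And>z w. norm z = 1 \<Longrightarrow> symbol D z (G z w) = w" by metis
  \<comment> \<open>The period is the size of \<open>W n\<close>, which is therefore a complete
    system of residues.\<close>
  define N :: "nat \<Rightarrow> nat" where "N n = 2 * n + 1" for n
  have N0: "N n > 0" for n by (simp add: N_def)
  define W where "W n = {-int n..int n}" for n
  \<comment> \<open>The discrete Fourier coefficients of \<open>b\<close> on \<open>W n\<close>;
    \<open>xs n\<close> below applies the inverse symbol \<open>G\<close> to each of them and
    transforms back.\<close>
  define bh where "bh n z = (1 / of_nat (N n)) *s (\<Sum>j\<in>W n. z powi j *s b j)" for n and z :: complex
  define xs where "xs n i = (\<Sum>z | z ^ N n = 1. z powi (-i) *s G z (bh n z))" for n and i :: int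
  have root: "norm z = 1" if "z ^ N n = 1" for z :: complex and n
    using norm_root_unity[OF _ that] by (simp add: N_def)
  have xs_linf: "xs n \<in> linf" for n
  proof -
    have "norm (xs n i) \<le> (\<Sum>z | z ^ N n = 1. norm (G z (bh n z)))" for i
      unfolding xs_def by (rule sum_norm_le) (simp add: norm_vector_smult norm_power_int root)
    then show ?thesis unfolding linf_def mem_Collect_eq bounded_iff by blast
  qed
  \<comment> \<open>The right-hand side is the periodic extension of \<open>b\<close> from
    \<open>W n\<close>: by \<open>uniq\<close> below, at most one index \<open>j\<close>
    contributes.\<close>
  have Dxs: "laurent_op D (xs n) i = (\<Sum>j\<in>W n. if int (N n) dvd j - i then b j else 0)" for n i
  proof -
    have "laurent_op D (xs n) i = (\<Sum>z | z ^ N n = 1. z powi (-i) *s bh n z)"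
      unfolding xs_def
      by (subst laurent_op_sum) (auto simp: linf_exponential root laurent_op_exponential G)
    also have "\<dots> = (\<Sum>z | z ^ N n = 1. \<Sum>j\<in>W n. (1 / of_nat (N n) * z powi (j - i)) *s b j)"
    proof (intro sum.cong refl)
      fix z assume "z \<in> {z::complex. z ^ N n = 1}"
      then have "z \<noteq> 0" using root[of z n] by auto
      then show "z powi (-i) *s bh n z = (\<Sum>j\<in>W n. (1 / of_nat (N n) * z powi (j - i)) *s b j)"
        by (simp add: bh_def linear_sum[OF bounded_linear.linear[OF bounded_linear_vector_smult]]
            vector_smult_assoc power_int_diff power_int_minus field_simps)
    qed
    also have "\<dots> = (\<Sum>j\<in>W n. (1 / of_nat (N n) * (\<Sum>z | z ^ N n = 1. z powi (j - i))) *s b j)"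
      unfolding sum_distrib_left vec.scale_sum_left by (rule sum.swap)
    also have "\<dots> = (\<Sum>j\<in>W n. if int (N n) dvd j - i then b j else 0)"
      using N0[of n] by (intro sum.cong refl) (simp add: sum_roots_unity_powi[OF N0])
    finally show ?thesis .
  qed
  have uniq: "j = j'" if "j \<in> W n" "j' \<in> W n" "int (N n) dvd j - i" "int (N n) dvd j' - i" for n i j j'
  proof (rule ccontr)
    assume "j \<noteq> j'"
    have "int (N n) dvd j - j'" using dvd_diff[OF that(3,4)] by simp
    with \<open>j \<noteq> j'\<close> have "int (N n) \<le> \<bar>j - j'\<bar>"
      by (intro dvd_imp_le_int[of "j - j'" "int (N n)", simplified]) auto
    then show False using that by (auto simp: N_def W_def)
  qed
  have pick: "laurent_op D (xs n) i = b j" if "j \<in> W n" "int (N n) dvd j - i" for n i j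
  proof -
    have "laurent_op D (xs n) i = (\<Sum>j'\<in>W n. if j' = j then b j' else 0)"
      unfolding Dxs by (intro sum.cong refl) (use that uniq in auto)
    then show ?thesis using that by (simp add: W_def)
  qed
  have "norm (laurent_op D (xs n) i) \<le> s" for n i
  proof (cases "\<exists>j\<in>W n. int (N n) dvd j - i")
    case True
    then show ?thesis using pick s by metis
  next
    case False
    then have "laurent_op D (xs n) i = 0" unfolding Dxs by (intro sum.neutral) auto
    then show ?thesis using \<open>s \<ge> 0\<close> by simp
  qed
  then have xs_le: "norm (xs n i) \<le> C * s" for n i
    by (intro C(2) xs_linf)
  \<comment> \<open>A diagonal subsequence over the countably many indices.\<close>
  obtain r where r: "strict_mono r" "\<And>i. \<exists>l. (\<lambda>n. xs (r n) i) \<longlonglongrightarrow> l"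
    using function_convergent_subsequence[of "UNIV :: int set" xs "C * s"] xs_le by auto
  then obtain x where x: "\<And>i. (\<lambda>n. xs (r n) i) \<longlonglongrightarrow> x i" by metis
  have "norm (x i) \<le> C * s" for i
    using tendsto_norm[OF x[of i]] xs_le by (intro LIMSEQ_le_const2[of "\<lambda>n. norm (xs (r n) i)"]) auto
  then have "x \<in> linf" unfolding linf_def mem_Collect_eq bounded_iff by blast
  moreover have "laurent_op D x i = b i" for i
  proof (rule LIMSEQ_unique)
    show "(\<lambda>n. laurent_op D (xs (r n)) i) \<longlonglongrightarrow> laurent_op D x i"
      by (rule laurent_op_tendsto[OF xs_le x])
    \<comment> \<open>Since \<open>r n\<close> is at least \<open>n\<close>, the index
      \<open>i\<close> lies in \<open>W (r n)\<close>, where the periodic data agree with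
      \<open>b\<close>.\<close>
    have "laurent_op D (xs (r n)) i = b i" if "n \<ge> nat \<bar>i\<bar>" for n
    proof (rule pick)
      have "n \<le> r n" using r(1) by (rule strict_mono_imp_increasing)
      then show "i \<in> W (r n)" using that by (auto simp: W_def)
    qed simp
    then have "\<forall>\<^sub>F n in sequentially. laurent_op D (xs (r n)) i = b i"
      by (auto simp: eventually_sequentially)
    then show "(\<lambda>n. laurent_op D (xs (r n)) i) \<longlonglongrightarrow> b i"
      by (rule tendsto_eventually)
  qed
  ultimately show ?thesis using that by blast
qed

text \<open>The sup norm lower bound serves twice: with \<open>s = 0\<close> it gives uniqueness of
  solutions, and in general it bounds the inverse whose existence follows from surjectivity.\<close>

lemma laurent_op_invertible:
  assumes inj: "\<And>z v. norm z = 1 \<Longrightarrow> v \<noteq> 0 \<Longrightarrow> symbol D z v \<noteq> 0"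
  shows "\<exists>M. (\<forall>x\<in>linf. M x \<in> linf) \<and> (\<exists>K. \<forall>x\<in>linf. supnorm (M x) \<le> K * supnorm x) \<and>
    (\<forall>x\<in>linf. M (laurent_op D x) = x) \<and> (\<forall>x\<in>linf. laurent_op D (M x) = x)"
proof -
  obtain c where c: "c > 0" "\<And>z v. norm z = 1 \<Longrightarrow> c * norm v \<le> norm (symbol D z v)"
    using symbol_lower_bound[OF inj] by blast
  obtain C where C: "C > 0"
    "\<And>x s i. x \<in> linf \<Longrightarrow> (\<And>j. norm (laurent_op D x j) \<le> s) \<Longrightarrow> norm (x i) \<le> C * s"
    using laurent_op_bounded_below[OF c] by blast
  have unique: "x = y" if "x \<in> linf" "y \<in> linf" "laurent_op D x = laurent_op D y" for x y
  proof
    fix i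
    have "norm (x i - y i) \<le> C * 0"
      by (rule C(2)[OF linf_diff]) (use that in \<open>simp_all add: laurent_op_diff\<close>)
    then show "x i = y i" by simp
  qed
  define M where "M b = (SOME x. x \<in> linf \<and> laurent_op D x = b)" for b
  have M: "M b \<in> linf" "laurent_op D (M b) = b" if "b \<in> linf" for b
  proof -
    have "\<exists>x. x \<in> linf \<and> laurent_op D x = b"
      using laurent_op_surj[OF inj that] by blast
    from someI_ex[OF this] show "M b \<in> linf" "laurent_op D (M b) = b" by (simp_all add: M_def)
  qed
  have "supnorm (M b) \<le> C * supnorm b" if "b \<in> linf" for b
    unfolding supnorm_def[of "M b"]
  proof (rule cSUP_least)
    have "bdd_above (range (\<lambda>i. norm (b i)))"
      using that by (auto simp: linf_def bounded_iff intro: bdd_aboveI2)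
    then have "norm (b j) \<le> supnorm b" for j
      unfolding supnorm_def by (intro cSUP_upper) auto
    then show "norm (M b i) \<le> C * supnorm b" for i
      by (intro C(2)) (simp_all add: M that)
  qed simp
  moreover have "M (laurent_op D x) = x" if "x \<in> linf" for x
    using that by (intro unique[OF M(1) that M(2)] laurent_op_linf)
  ultimately show ?thesis using M by blast
qed

text \<open>Subtracting \<open>c\<close> times the identity from the block at index 0 gives a kernel
  \<open>E\<close> whose operator and symbol are those of \<open>D\<close> minus \<open>c\<close>.
  If the symbol of \<open>E\<close> is injective on the circle, then
  \<open>laurent_op_invertible\<close> applies; otherwise a bounded exponential lies in the kernel
  of the operator.\<close>

lemma linf_spectrum_laurent_op:
  "linf_spectrum (laurent_op D) = {c. \<exists>z v. norm z = 1 \<and> v \<noteq> 0 \<and> symbol D z v = c *s v}"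
proof -
  have "c \<in> linf_spectrum (laurent_op D) \<longleftrightarrow> (\<exists>z v. norm z = 1 \<and> v \<noteq> 0 \<and> symbol D z v = c *s v)" for c
  proof -
    define E where "E k = D k - (if k = 0 then Finite_Cartesian_Product.mat c else 0)" for k :: int
    have E: "E k *v v = D k *v v + (if k = 0 then - (c *s v) else 0)" for k v
      by (simp add: E_def matrix_vector_mult_diff_rdistrib mat_vector_mult)
    interpret E: summable_kernel E "\<lambda>k. B k + (if k = 0 then norm c else 0)"
    proof
      show "norm (E k *v v) \<le> (B k + (if k = 0 then norm c else 0)) * norm v" for k v
        using norm_triangle_ineq[of "D k *v v" "- (c *s v)"] norm_le[of k v]
        by (auto simp: E norm_vector_smult algebra_simps)
      show "(\<lambda>k. B k + (if k = 0 then norm c else 0)) summable_on UNIV"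
        by (intro summable_on_add summable_B finite_nonzero_values_imp_summable_on)
           (auto intro: finite_subset[of _ "{0}"])
    qed
    have delta: "((\<lambda>k. if k = 0 then w else 0) has_sum w) UNIV" for w :: "complex^2"
      by (rule has_sum_finite_neutralI[of "{0}"]) auto
    have lop: "laurent_op E x = (\<lambda>i. laurent_op D x i - c *s x i)" if "x \<in> linf" for x
    proof
      fix i
      have "((\<lambda>k. D k *v x (i - k) + (if k = 0 then - (c *s x i) else 0)) has_sum
          (laurent_op D x i + - (c *s x i))) UNIV"
        by (intro has_sum_add conv_has_sum that delta)
      also have "(\<lambda>k. D k *v x (i - k) + (if k = 0 then - (c *s x i) else 0)) = (\<lambda>k. E k *v x (i - k))"
        by (auto simp: E)
      finally show "laurent_op E x i = laurent_op D x i - c *s x i"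
        unfolding E.laurent_op_conv by (simp add: infsumI)
    qed
    have sym: "symbol E z v = symbol D z v - c *s v" if "norm z = 1" for z v
    proof -
      have "((\<lambda>k. z powi k *s (D k *v v) + (if k = 0 then - (c *s v) else 0)) has_sum
          (symbol D z v + - (c *s v))) UNIV"
        by (intro has_sum_add symbol_has_sum that delta)
      also have "(\<lambda>k. z powi k *s (D k *v v) + (if k = 0 then - (c *s v) else 0)) = (\<lambda>k. z powi k *s (E k *v v))"
        by (auto simp: E)
      finally show ?thesis
        unfolding symbol_def[of E] by (simp add: infsumI)
    qed
    have iff: "c \<in> linf_spectrum (laurent_op D) \<longleftrightarrow>
       \<not> (\<exists>M. (\<forall>x\<in>linf. M x \<in> linf) \<and> (\<exists>K. \<forall>x\<in>linf. supnorm (M x) \<le> K * supnorm x) \<and>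
       (\<forall>x\<in>linf. M (laurent_op E x) = x) \<and> (\<forall>x\<in>linf. laurent_op E (M x) = x))"
      unfolding linf_spectrum_def mem_Collect_eq
      by (intro arg_cong[where f = Not] ex_cong1) (simp add: lop cong: conj_cong)
    show ?thesis
    proof
      assume c: "c \<in> linf_spectrum (laurent_op D)"
      show "\<exists>z v. norm z = 1 \<and> v \<noteq> 0 \<and> symbol D z v = c *s v"
      proof (rule ccontr)
        assume "\<not> ?thesis"
        then have "symbol E z v \<noteq> 0" if "norm z = 1" "v \<noteq> 0" for z v
          using that by (auto simp: sym)
        from E.laurent_op_invertible[OF this] c show False by (simp add: iff)
      qed
    next
      assume "\<exists>z v. norm z = 1 \<and> v \<noteq> 0 \<and> symbol D z v = c *s v"
      then obtain z v where zv: "norm z = 1" "v \<noteq> 0" "symbol E z v = 0"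
        using sym by auto
      define x where "x = (\<lambda>j. z powi (-j) *s v)"
      have x: "x \<in> linf" unfolding x_def by (rule linf_exponential[OF zv(1)])
      have 0: "(\<lambda>_. 0) \<in> linf" by (simp add: linf_def)
      have "laurent_op E x = (\<lambda>_. 0)"
        unfolding x_def by (rule ext) (simp add: E.laurent_op_exponential[OF zv(1)] zv(3))
      also have "\<dots> = laurent_op E (\<lambda>_. 0)"
        by (rule ext) (simp add: E.laurent_op_conv)
      finally have "laurent_op E x = laurent_op E (\<lambda>_. 0)" .
      \<comment> \<open>A left inverse would identify the exponential with the zero sequence, but
        its entry at 0 is \<open>v\<close>.\<close>
      then have "x = (\<lambda>_. 0)" if "\<forall>x\<in>linf. M (laurent_op E x) = x" for M
        using that x 0 by metis
      moreover have "x \<noteq> (\<lambda>_. 0)" using zv(2) by (auto simp: x_def fun_eq_iff intro!: exI[of _ 0])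
      ultimately show "c \<in> linf_spectrum (laurent_op D)"
        unfolding iff by blast
    qed
  qed
  then show ?thesis by blast
qed

end

section \<open>Vectors with two entries and summability of the decaying kernel\<close>

text \<open>Arithmetic in the type \<open>2\<close> is modulo 2. This translates facts indexed by 1
  and 2 into the indices 0 and 1 of the blocks.\<close>

lemma two_eq_zero: "(2::2) = 0"
  by simp

lemma sum_UNIV_2_01: "(\<Sum>i\<in>UNIV. f (i::2)) = f 0 + f 1"
  unfolding sum_2 two_eq_zero by (rule add.commute)

lemma vec2_eq_iff: "v = w \<longleftrightarrow> vec_nth v 0 = vec_nth w 0 \<and> vec_nth v 1 = vec_nth (w :: 'a^2) 1"
  unfolding Finite_Cartesian_Product.vec_eq_iff forall_2 two_eq_zero by (rule conj_commute)

text \<open>The decay exponent \<open>1 + \<delta>\<close> exceeds 1, so comparison with a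
  convergent p-series applies.\<close>

lemma kernel_summable_nat:
  assumes "kernel_ok \<omega>" "T > 0"
  shows "summable (\<lambda>n::nat. \<bar>\<omega> (x + real n * T)\<bar>)"
proof -
  obtain C \<delta> where C: "C > 0" "\<delta> > 0" "\<And>x. \<bar>\<omega> x\<bar> \<le> C * (1 + \<bar>x\<bar>) powr (-1 - \<delta>)"
    using assms unfolding kernel_ok_def by blast
  have "(\<lambda>n::nat. C * (1 + \<bar>x + real n * T\<bar>) powr (-1 - \<delta>)) \<in> O(\<lambda>n. real n powr (-1 - \<delta>))"
    using C assms(2) by real_asymp
  moreover have "summable (\<lambda>n::nat. norm (real n powr (-1 - \<delta>)))"
    using C(2) by (simp add: summable_real_powr_iff)
  ultimately have "summable (\<lambda>n::nat. C * (1 + \<bar>x + real n * T\<bar>) powr (-1 - \<delta>))"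
    by (rule summable_comparison_test_bigo[rotated])
  then show ?thesis
    by (rule summable_comparison_test_ev[rotated]) (auto simp: C(3))
qed

text \<open>Evenness of the kernel reflects the negative indices to positive ones, with
  \<open>x\<close> replaced by \<open>-x\<close>.\<close>

lemma kernel_summable_int:
  assumes "kernel_ok \<omega>" "T > 0"
  shows "(\<lambda>k::int. \<bar>\<omega> (x + of_int k * T)\<bar>) summable_on UNIV"
proof -
  have even: "\<omega> (-x) = \<omega> x" for x using assms by (simp add: kernel_ok_def)
  have nat: "(\<lambda>n::nat. \<bar>\<omega> (y + real n * T)\<bar>) summable_on UNIV" for y
    using kernel_summable_nat[OF assms] by (simp add: summable_on_UNIV_nonneg_real_iff)
  have "(\<lambda>k. \<bar>\<omega> (x + of_int k * T)\<bar>) summable_on (int ` UNIV)"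
    by (subst summable_on_reindex) (use nat[of x] in \<open>auto simp: o_def\<close>)
  moreover have "(\<lambda>k. \<bar>\<omega> (x + of_int k * T)\<bar>) summable_on ((\<lambda>n. - int n) ` UNIV)"
  proof (subst summable_on_reindex)
    have "\<bar>\<omega> (x + of_int (- int n) * T)\<bar> = \<bar>\<omega> (-x + real n * T)\<bar>" for n
      using even[of "x + of_int (- int n) * T"] by (simp add: algebra_simps)
    then show "((\<lambda>k. \<bar>\<omega> (x + of_int k * T)\<bar>) \<circ> (\<lambda>n. - int n)) summable_on UNIV"
      using nat[of "-x"] by (simp add: o_def)
  qed (simp add: inj_on_def)
  ultimately have "(\<lambda>k. \<bar>\<omega> (x + of_int k * T)\<bar>) summable_on (int ` UNIV \<union> (\<lambda>n. - int n) ` UNIV)"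
    by (rule summable_on_union)
  moreover have "int ` UNIV \<union> (\<lambda>n. - int n) ` UNIV = UNIV"
    by (auto simp: image_iff) (metis int_cases2)
  ultimately show ?thesis by simp
qed

section \<open>Periodized kernels and block circulant matrices\<close>

lemma norm_vec2_le: "norm (v :: complex^2) \<le> norm (vec_nth v 0) + norm (vec_nth v 1)"
  unfolding norm_vec_def using L2_set_le_sum[of UNIV "\<lambda>i. norm (vec_nth v i)"]
  by (simp add: sum_UNIV_2_01)

lemma matrix_vector_mult_2:
  "vec_nth ((A :: complex^2^2) *v v) r
     = vec_nth (vec_nth A r) 0 * vec_nth v 0 + vec_nth (vec_nth A r) 1 * vec_nth v 1"
  by (simp add: matrix_vector_mult_def sum_UNIV_2_01)

text \<open>Both sides are equivalent to the characteristic equation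
  \<open>(c - \<alpha>)\<^sup>2 = \<beta> * cnj \<beta>\<close>.\<close>

lemma hermitian2_eigenvalue_iff:
  fixes \<alpha> \<beta> c :: complex
  shows "(\<exists>v0 v1. (v0 \<noteq> 0 \<or> v1 \<noteq> 0) \<and> \<alpha> * v0 + \<beta> * v1 = c * v0 \<and> cnj \<beta> * v0 + \<alpha> * v1 = c * v1)
    \<longleftrightarrow> c = \<alpha> + of_real (norm \<beta>) \<or> c = \<alpha> - of_real (norm \<beta>)" (is "?L \<longleftrightarrow> ?R")
proof -
  have R: "?R \<longleftrightarrow> (c - \<alpha>)\<^sup>2 = \<beta> * cnj \<beta>"
    unfolding complex_norm_square[symmetric] of_real_power power2_eq_iff by (auto simp: algebra_simps)
  show ?thesis
  proof
    assume ?L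
    then obtain v0 v1 where v: "v0 \<noteq> 0 \<or> v1 \<noteq> 0"
      and 1: "(c - \<alpha>) * v0 = \<beta> * v1" and 2: "(c - \<alpha>) * v1 = cnj \<beta> * v0"
      by (force simp: algebra_simps)
    \<comment> \<open>Eliminating either unknown gives the characteristic equation multiplied by the
      other one, and one of the two is nonzero.\<close>
    have "(c - \<alpha>)\<^sup>2 * v0 = \<beta> * ((c - \<alpha>) * v1)"
      by (simp only: power2_eq_square mult.assoc 1 mult.left_commute[of _ \<beta>])
    moreover have "(c - \<alpha>)\<^sup>2 * v1 = cnj \<beta> * ((c - \<alpha>) * v0)"
      by (simp only: power2_eq_square mult.assoc 2 mult.left_commute[of _ "cnj \<beta>"])
    ultimately show ?R unfolding R 1 2 using v by auto
  next
    assume ?R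
    then have sq: "(c - \<alpha>)\<^sup>2 = \<beta> * cnj \<beta>" by (simp only: R)
    show ?L
    proof (cases "\<beta> = 0")
      case True
      then show ?thesis using sq by (intro exI[of _ 1] exI[of _ 0]) auto
    next
      case False
      then show ?thesis using sq
        \<comment> \<open>The vector with entries \<open>\<beta>\<close> and
          \<open>c - \<alpha>\<close> satisfies the first row identically and the second by the
          characteristic equation.\<close>
        by (intro exI[of _ \<beta>] exI[of _ "c - \<alpha>"]) (auto simp: power2_eq_square algebra_simps)
    qed
  qed
qed

lemma powi_mod_root_unity:
  fixes z :: complex
  assumes "N > 0" "z ^ N = 1"
  shows "z powi (m mod int N) = z powi m"
proof -
  have "z \<noteq> 0" using norm_root_unity[OF assms] by auto
  have "z powi m = z powi (int N * (m div int N) + m mod int N)" by simp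
  also have "\<dots> = z powi (m mod int N)"
    using \<open>z \<noteq> 0\<close> assms(2) by (subst power_int_add) (auto simp: power_int_mult)
  finally show ?thesis by simp
qed

text \<open>The substitution \<open>n = (J - I) mod N\<close> is compatible with powers of
  \<open>z\<close> because \<open>z ^ N = 1\<close>. Geometric sequences are thus right eigenvectors
  of circulant matrices.\<close>

lemma circulant_row_sum:
  fixes F :: "int \<Rightarrow> complex"
  assumes "N > 0" "z ^ N = 1"
  shows "(\<Sum>J<N. F ((int J - int I) mod int N) * z ^ J) = z ^ I * (\<Sum>n<N. F (int n) * z ^ n)"
proof -
  have "z \<noteq> 0" using norm_root_unity[OF assms] by auto
  have "(\<Sum>J<N. F ((int J - int I) mod int N) * z ^ J)
      = (\<Sum>J<N. z ^ I * (F ((int J - int I) mod int N) * z powi ((int J - int I) mod int N)))"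
    unfolding powi_mod_root_unity[OF assms]
    using \<open>z \<noteq> 0\<close> by (simp add: power_int_diff)
  also have "\<dots> = (\<Sum>n<N. z ^ I * (F (int n) * z ^ n))"
    by (rule sum.reindex_bij_witness[where i = "\<lambda>n. nat ((int n + int I) mod int N)"
          and j = "\<lambda>J. nat ((int J - int I) mod int N)"])
       (use assms(1) in \<open>auto simp: nat_less_iff mod_simps power_int_def\<close>)
  finally show ?thesis by (simp add: sum_distrib_left)
qed

text \<open>The counterpart for left eigenvectors, with \<open>inverse z\<close> so that the same
  Fourier sum in \<open>z\<close> appears.\<close>

lemma circulant_column_sum:
  fixes F :: "int \<Rightarrow> complex"
  assumes "N > 0" "z ^ N = 1"
  shows "(\<Sum>I<N. F ((int J - int I) mod int N) * inverse z ^ I)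
       = inverse z ^ J * (\<Sum>n<N. F (int n) * z ^ n)"
proof -
  have "z \<noteq> 0" using norm_root_unity[OF assms] by auto
  have "(\<Sum>I<N. F ((int J - int I) mod int N) * inverse z ^ I)
      = (\<Sum>I<N. inverse z ^ J * (F ((int J - int I) mod int N) * z powi ((int J - int I) mod int N)))"
    unfolding powi_mod_root_unity[OF assms]
    using \<open>z \<noteq> 0\<close> by (simp add: power_int_diff power_inverse field_simps)
  also have "\<dots> = (\<Sum>n<N. inverse z ^ J * (F (int n) * z ^ n))"
    by (rule sum.reindex_bij_witness[where i = "\<lambda>n. nat ((int J - int n) mod int N)"
          and j = "\<lambda>I. nat ((int J - int I) mod int N)"])
       (use assms(1) in \<open>auto simp: nat_less_iff mod_simps power_int_def\<close>)
  finally show ?thesis by (simp add: sum_distrib_left)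
qed

lemma even_odd_less_double:
  assumes "i < 2 * (N::nat)"
  obtains I where "I < N" "i = 2 * I" | I where "I < N" "i = 2 * I + 1"
  using assms by (cases "even i") (auto elim!: evenE oddE)

lemma sum_lessThan_double: "(\<Sum>s<2 * N. f s) = (\<Sum>J<N. f (2 * J) + f (2 * J + 1))"
  for f :: "nat \<Rightarrow> 'a::comm_monoid_add"
  by (induction N) (simp_all add: add.assoc)

locale periodized_kernel =
  fixes \<omega> :: "real \<Rightarrow> real" and T a d :: real
  assumes ker: "kernel_ok \<omega>" and T_pos: "T > 0"
begin

text \<open>One family covers all entries of the blocks: the shifts \<open>x\<close> that occur are
  0, \<open>-2 * a\<close> and \<open>2 * a\<close>.\<close>

definition coef :: "real \<Rightarrow> int \<Rightarrow> complex" where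
  "coef x k = complex_of_real (1 / d * \<omega> (x + of_int k * T))"

definition scalar_symbol :: "real \<Rightarrow> complex \<Rightarrow> complex" where
  "scalar_symbol x z = (\<Sum>\<^sub>\<infinity>k. coef x k * z powi k)"

lemma norm_coef_summable: "(\<lambda>k. norm (coef x k)) summable_on UNIV"
  using summable_on_cmult_right[OF kernel_summable_int[OF ker T_pos, of x], of "\<bar>1 / d\<bar>"]
  unfolding coef_def norm_of_real abs_mult .

lemma norm_coef_powi: "norm z = 1 \<Longrightarrow> norm (coef x k * z powi k) = norm (coef x k)"
  by (simp add: norm_mult norm_power_int)

lemma scalar_symbol_has_sum:
  assumes "norm z = 1"
  shows "((\<lambda>k. coef x k * z powi k) has_sum scalar_symbol x z) UNIV"
proof -
  have "(\<lambda>k. norm (coef x k * z powi k)) summable_on UNIV"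
    unfolding norm_coef_powi[OF assms] by (rule norm_coef_summable)
  then show ?thesis
    unfolding scalar_symbol_def by (intro has_sum_infsum) (rule abs_summable_summable)
qed

lemma continuous_on_scalar_symbol: "continuous_on (sphere 0 1) (scalar_symbol x)"
proof (rule uniform_limit_theorem)
  show "\<forall>\<^sub>F F in finite_subsets_at_top UNIV. continuous_on (sphere 0 1) (\<lambda>z. \<Sum>k\<in>F. coef x k * z powi k)"
    by (intro always_eventually allI continuous_intros) auto
  show "uniform_limit (sphere 0 1) (\<lambda>F z. \<Sum>k\<in>F. coef x k * z powi k) (scalar_symbol x) (finite_subsets_at_top UNIV)"
    unfolding scalar_symbol_def[abs_def]
    by (rule Weierstrass_m_test_general[OF _ norm_coef_summable[of x]]) (simp add: norm_mult norm_power_int)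
qed simp

text \<open>On the circle conjugation turns \<open>z powi k\<close> into \<open>z powi (-k)\<close>;
  reversing the index and using that the kernel is real and even moves the sign to \<open>x\<close>.
  Hence the symbol is Hermitian.\<close>

lemma cnj_scalar_symbol:
  assumes "norm z = 1"
  shows "cnj (scalar_symbol x z) = scalar_symbol (-x) z"
proof -
  have even: "\<omega> (-x) = \<omega> x" for x using ker by (simp add: kernel_ok_def)
  have "cnj (scalar_symbol x z) = (\<Sum>\<^sub>\<infinity>k. coef x k * z powi (-k))"
    unfolding scalar_symbol_def infsum_cnj[symmetric]
    by (simp add: coef_def cnj_eq_inverse[OF assms] power_int_inverse power_int_minus)
  also have "\<dots> = scalar_symbol (-x) z"
    unfolding scalar_symbol_def
  proof (rule infsum_reindex_bij_witness[where i = uminus and j = uminus])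
    show "coef (- x) (- k) * z powi (- k) = coef x k * z powi (- k)" for k
      using even[of "x + of_int k * T"] by (simp add: coef_def)
  qed auto
  finally show ?thesis .
qed

lemma Ablock_nth:
  "vec_nth (vec_nth (Ablock \<omega> T a d k) 0) 0 = coef 0 k"
  "vec_nth (vec_nth (Ablock \<omega> T a d k) 0) 1 = coef (-2 * a) k"
  "vec_nth (vec_nth (Ablock \<omega> T a d k) 1) 0 = coef (2 * a) k"
  "vec_nth (vec_nth (Ablock \<omega> T a d k) 1) 1 = coef 0 k"
  by (simp_all add: Ablock_def coef_def)

sublocale summable_kernel "Ablock \<omega> T a d"
  "\<lambda>k. (norm (coef 0 k) + norm (coef (-2 * a) k)) + (norm (coef (2 * a) k) + norm (coef 0 k))"
proof
  show "norm (Ablock \<omega> T a d k *v v)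
     \<le> ((norm (coef 0 k) + norm (coef (-2 * a) k)) + (norm (coef (2 * a) k) + norm (coef 0 k))) * norm v" for k v
  proof -
    have *: "norm (p * vec_nth v 0 + q * vec_nth v 1) \<le> (norm p + norm q) * norm v" for p q
      using norm_triangle_ineq[of "p * vec_nth v 0" "q * vec_nth v 1"]
        mult_left_mono[OF Finite_Cartesian_Product.norm_nth_le[of v 0] norm_ge_zero[of p]]
        mult_left_mono[OF Finite_Cartesian_Product.norm_nth_le[of v 1] norm_ge_zero[of q]]
      by (simp add: norm_mult algebra_simps)
    show ?thesis
      using norm_vec2_le[of "Ablock \<omega> T a d k *v v"] *[of "coef 0 k" "coef (-2 * a) k"]
        *[of "coef (2 * a) k" "coef 0 k"]
      unfolding matrix_vector_mult_2 Ablock_nth distrib_right[of "_ + _"] by linarith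
  qed
  show "(\<lambda>k. (norm (coef 0 k) + norm (coef (-2 * a) k)) + (norm (coef (2 * a) k) + norm (coef 0 k))) summable_on UNIV"
    by (intro summable_on_add norm_coef_summable)
qed

lemma symbol_nth:
  assumes "norm z = 1"
  shows "vec_nth (symbol (Ablock \<omega> T a d) z v) 0 = scalar_symbol 0 z * vec_nth v 0 + scalar_symbol (-2 * a) z * vec_nth v 1"
    and "vec_nth (symbol (Ablock \<omega> T a d) z v) 1 = scalar_symbol (2 * a) z * vec_nth v 0 + scalar_symbol 0 z * vec_nth v 1"
proof -
  have comb: "((\<lambda>k. z powi k * (coef x k * p + coef y k * q)) has_sum (scalar_symbol x z * p + scalar_symbol y z * q)) UNIV"
    for x y p q
    using has_sum_add[OF has_sum_cmult_left[OF scalar_symbol_has_sum[OF assms, of x], of p]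
        has_sum_cmult_left[OF scalar_symbol_has_sum[OF assms, of y], of q]]
    by (simp add: algebra_simps)
  note * = has_sum_bounded_linear[OF bounded_linear_vec_nth symbol_has_sum[OF assms, of v]]
  show "vec_nth (symbol (Ablock \<omega> T a d) z v) 0 = scalar_symbol 0 z * vec_nth v 0 + scalar_symbol (-2 * a) z * vec_nth v 1"
    using *[of 0] comb[of 0 "vec_nth v 0" "-2 * a" "vec_nth v 1"]
    unfolding vector_smult_component matrix_vector_mult_2 Ablock_nth by (rule has_sum_unique)
  show "vec_nth (symbol (Ablock \<omega> T a d) z v) 1 = scalar_symbol (2 * a) z * vec_nth v 0 + scalar_symbol 0 z * vec_nth v 1"
    using *[of 1] comb[of "2 * a" "vec_nth v 0" 0 "vec_nth v 1"]
    unfolding vector_smult_component matrix_vector_mult_2 Ablock_nth by (rule has_sum_unique)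
qed

text \<open>The closed form exhibits two branches that depend continuously on \<open>z\<close>,
  which an eigenvalue set defined through eigenvectors would hide.\<close>

definition symbol_eigenvalues :: "complex \<Rightarrow> complex set" where
  "symbol_eigenvalues z = {scalar_symbol 0 z + of_real (norm (scalar_symbol (-2 * a) z)), scalar_symbol 0 z - of_real (norm (scalar_symbol (-2 * a) z))}"

lemma symbol_eigenvalues_iff:
  assumes "norm z = 1"
  shows "c \<in> symbol_eigenvalues z \<longleftrightarrow> (\<exists>v0 v1. (v0 \<noteq> 0 \<or> v1 \<noteq> 0) \<and>
     scalar_symbol 0 z * v0 + scalar_symbol (-2 * a) z * v1 = c * v0 \<and> scalar_symbol (2 * a) z * v0 + scalar_symbol 0 z * v1 = c * v1)"
  using hermitian2_eigenvalue_iff[of "scalar_symbol 0 z" "scalar_symbol (-2 * a) z" c]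
  by (simp add: symbol_eigenvalues_def cnj_scalar_symbol[OF assms])

lemma linf_spectrum_eq: "linf_spectrum (laurent_op (Ablock \<omega> T a d)) = (\<Union>z\<in>sphere 0 1. symbol_eigenvalues z)"
proof -
  have eigs: "(\<exists>v. v \<noteq> 0 \<and> symbol (Ablock \<omega> T a d) z v = c *s v) \<longleftrightarrow> c \<in> symbol_eigenvalues z" if z1: "norm z = 1" for z c
  proof
    assume "\<exists>v. v \<noteq> 0 \<and> symbol (Ablock \<omega> T a d) z v = c *s v"
    then obtain v where "v \<noteq> 0" "symbol (Ablock \<omega> T a d) z v = c *s v" by blast
    then show "c \<in> symbol_eigenvalues z"
      unfolding symbol_eigenvalues_iff[OF z1] vec2_eq_iff symbol_nth[OF z1]
      by (intro exI[of _ "vec_nth v 0"] exI[of _ "vec_nth v 1"]) auto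
  next
    assume "c \<in> symbol_eigenvalues z"
    then obtain v0 v1 where v: "v0 \<noteq> 0 \<or> v1 \<noteq> 0" "scalar_symbol 0 z * v0 + scalar_symbol (-2 * a) z * v1 = c * v0"
       "scalar_symbol (2 * a) z * v0 + scalar_symbol 0 z * v1 = c * v1"
      unfolding symbol_eigenvalues_iff[OF z1] by blast
    define v :: "complex^2" where "v = (\<chi> i. if i = 0 then v0 else v1)"
    have "vec_nth v 0 = v0" "vec_nth v 1 = v1" by (simp_all add: v_def)
    then show "\<exists>v. v \<noteq> 0 \<and> symbol (Ablock \<omega> T a d) z v = c *s v"
      using v by (intro exI[of _ v]) (auto simp: vec2_eq_iff symbol_nth[OF z1])
  qed
  show ?thesis
    unfolding linf_spectrum_laurent_op set_eq_iff mem_Collect_eq UN_iff using eigs by (metis mem_sphere_0)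
qed

definition periodized_coef :: "nat \<Rightarrow> real \<Rightarrow> int \<Rightarrow> complex" where
  "periodized_coef N x n = complex_of_real (1 / d * omega_p \<omega> (x + of_int n * T) (real N * T))"

text \<open>Splitting the integers into residue classes modulo \<open>N\<close> groups the symbol
  series into periodized coefficients, since \<open>z powi k\<close> depends only on the class of
  \<open>k\<close>. At roots of unity the circulant matrix and the Laurent operator therefore share
  their symbol.\<close>

lemma sum_periodized_coef:
  assumes "N > 0" "z ^ N = 1"
  shows "(\<Sum>n<N. periodized_coef N x (int n) * z ^ n) = scalar_symbol x z"
proof -
  have z: "norm z = 1" using norm_root_unity[OF assms] .
  have "z \<noteq> 0" using z by auto
  let ?f = "\<lambda>k. coef x k * z powi k"
  have "(?f has_sum scalar_symbol x z) UNIV" by (rule scalar_symbol_has_sum[OF z])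
  also have "?this \<longleftrightarrow> ((\<lambda>(n, m). coef x (int n - m * int N) * z ^ n) has_sum scalar_symbol x z) ({..<N} \<times> UNIV)"
  \<comment> \<open>The quotient enters with a minus sign because \<open>omega_p\<close> subtracts
    the multiples of the period.\<close>
  proof (rule has_sum_reindex_bij_witness[where j = "\<lambda>k. (nat (k mod int N), - (k div int N))"
        and i = "\<lambda>(n, m). int n - m * int N"])
    show "(case (nat (k mod int N), - (k div int N)) of (n, m) \<Rightarrow> coef x (int n - m * int N) * z ^ n) = ?f k" for k
      using assms(1) powi_mod_root_unity[OF assms, of k] by (simp add: power_int_def)
  next
    fix b assume "b \<in> {..<N} \<times> (UNIV :: int set)"
    then obtain n m where "b = (n, m)" "n < N" by auto
    then show "(nat ((case b of (n, m) \<Rightarrow> int n - m * int N) mod int N),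
        - ((case b of (n, m) \<Rightarrow> int n - m * int N) div int N)) = b"
      using div_mult_self1[of "int N" "int n" "- m"] mod_mult_self1[of "int n" "- m" "int N"]
      by simp
  qed (use assms(1) in \<open>auto simp: nat_less_iff\<close>)
  finally have *: "((\<lambda>(n, m). coef x (int n - m * int N) * z ^ n) has_sum scalar_symbol x z) ({..<N} \<times> UNIV)" .
  have inner: "((\<lambda>m. coef x (int n - m * int N) * z ^ n) has_sum (periodized_coef N x (int n) * z ^ n)) UNIV" for n
  proof -
    have "(\<lambda>m. \<bar>\<omega> (-(x + int n * T) + of_int m * (real N * T))\<bar>) summable_on UNIV"
      using assms(1) T_pos by (intro kernel_summable_int ker) simp
    moreover have "\<omega> (-(x + int n * T) + of_int m * (real N * T)) = \<omega> (x + int n * T - of_int m * (real N * T))" for m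
      using ker unfolding kernel_ok_def by (metis minus_diff_eq uminus_add_conv_diff)
    ultimately have "(\<lambda>m. \<bar>\<omega> (x + int n * T - of_int m * (real N * T))\<bar>) summable_on UNIV"
      by simp
    then have "(\<lambda>m. \<omega> (x + int n * T - of_int m * (real N * T))) summable_on UNIV"
      by (subst summable_on_iff_abs_summable_on_real) simp
    then have "((\<lambda>m. \<omega> (x + int n * T - of_int m * (real N * T))) has_sum omega_p \<omega> (x + int n * T) (real N * T)) UNIV"
      unfolding omega_p_def by (rule has_sum_infsum)
    from has_sum_cmult_left[OF has_sum_of_real[OF has_sum_cmult_right[OF this, of "1 / d"]], of "z ^ n"]
    show ?thesis
      by (simp add: periodized_coef_def coef_def algebra_simps)
  qed
  have "((\<lambda>n. periodized_coef N x (int n) * z ^ n) has_sum scalar_symbol x z) {..<N}"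
    using has_sum_SigmaD[OF *] inner by simp
  then show ?thesis by (simp add: has_sum_finite_iff)
qed

lemma dim_row_circ_mat: "dim_row (circ_mat \<omega> T a d q) = 2 * (1 + q)"
  by (simp add: circ_mat_def)

lemma circ_mat_mult_nth:
  assumes "dim_vec w = 2 * N" "N = 1 + q" "I < N"
  shows "vec_index (circ_mat \<omega> T a d q *\<^sub>v w) (2 * I)
      = (\<Sum>J<N. periodized_coef N 0 ((int J - int I) mod int N) * vec_index w (2 * J)
              + periodized_coef N (-2 * a) ((int J - int I) mod int N) * vec_index w (2 * J + 1))"
    and "vec_index (circ_mat \<omega> T a d q *\<^sub>v w) (2 * I + 1)
      = (\<Sum>J<N. periodized_coef N (2 * a) ((int J - int I) mod int N) * vec_index w (2 * J)
              + periodized_coef N 0 ((int J - int I) mod int N) * vec_index w (2 * J + 1))"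
proof -
  have ent: "circ_mat \<omega> T a d q $$ (2 * I, 2 * J) = periodized_coef N 0 ((int J - int I) mod int N)"
    "circ_mat \<omega> T a d q $$ (2 * I, 2 * J + 1) = periodized_coef N (-2 * a) ((int J - int I) mod int N)"
    "circ_mat \<omega> T a d q $$ (2 * I + 1, 2 * J) = periodized_coef N (2 * a) ((int J - int I) mod int N)"
    "circ_mat \<omega> T a d q $$ (2 * I + 1, 2 * J + 1) = periodized_coef N 0 ((int J - int I) mod int N)" if "J < N" for J
    using that assms by (simp_all add: circ_mat_def periodized_coef_def)
  have mult: "vec_index (circ_mat \<omega> T a d q *\<^sub>v w) i
      = (\<Sum>s<2 * N. circ_mat \<omega> T a d q $$ (i, s) * vec_index w s)" if "i < 2 * N" for i
    using that assms
    by (simp add: scalar_prod_def atLeast0LessThan circ_mat_def)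
  show "vec_index (circ_mat \<omega> T a d q *\<^sub>v w) (2 * I)
      = (\<Sum>J<N. periodized_coef N 0 ((int J - int I) mod int N) * vec_index w (2 * J)
              + periodized_coef N (-2 * a) ((int J - int I) mod int N) * vec_index w (2 * J + 1))"
    using assms(3) by (subst mult) (auto simp: sum_lessThan_double ent simp del: One_nat_def)
  show "vec_index (circ_mat \<omega> T a d q *\<^sub>v w) (2 * I + 1)
      = (\<Sum>J<N. periodized_coef N (2 * a) ((int J - int I) mod int N) * vec_index w (2 * J)
              + periodized_coef N 0 ((int J - int I) mod int N) * vec_index w (2 * J + 1))"
    using assms(3) by (subst mult) (auto simp: sum_lessThan_double ent simp del: One_nat_def)
qed

text \<open>If \<open>v\<close> is an eigenvector of the symbol at \<open>z\<close>, then the block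
  vector with blocks \<open>z ^ J\<close> times \<open>v\<close> is an eigenvector of the circulant
  matrix.\<close>

lemma symbol_eigenvalue_in_mat_spectrum:
  assumes "z ^ (1 + q) = 1" "c \<in> symbol_eigenvalues z"
  shows "c \<in> mat_spectrum (circ_mat \<omega> T a d q)"
proof -
  define N where "N = 1 + q"
  have "N > 0" and zN: "z ^ N = 1" using assms by (simp_all add: N_def)
  have z: "norm z = 1" using norm_root_unity[OF \<open>N > 0\<close> zN] .
  have "z \<noteq> 0" using z by auto
  obtain v0 v1 where v: "v0 \<noteq> 0 \<or> v1 \<noteq> 0"
    "scalar_symbol 0 z * v0 + scalar_symbol (-2 * a) z * v1 = c * v0" "scalar_symbol (2 * a) z * v0 + scalar_symbol 0 z * v1 = c * v1"
    using assms(2) unfolding symbol_eigenvalues_iff[OF z] by blast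
  define w where "w = Matrix.vec (2 * N) (\<lambda>i. z ^ (i div 2) * (if even i then v0 else v1))"
  have dim: "dim_vec w = 2 * N" by (simp add: w_def)
  have w: "vec_index w (2 * J) = z ^ J * v0" "vec_index w (2 * J + 1) = z ^ J * v1" if "J < N" for J
    using that by (simp_all add: w_def)
  have comb: "(\<Sum>J<N. periodized_coef N x ((int J - int I) mod int N) * (z ^ J * v0) + periodized_coef N y ((int J - int I) mod int N) * (z ^ J * v1))
     = z ^ I * (scalar_symbol x z * v0 + scalar_symbol y z * v1)" for x y I
  proof -
    have "(\<Sum>J<N. periodized_coef N x ((int J - int I) mod int N) * (z ^ J * v0) + periodized_coef N y ((int J - int I) mod int N) * (z ^ J * v1))
      = (\<Sum>J<N. periodized_coef N x ((int J - int I) mod int N) * z ^ J) * v0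
        + (\<Sum>J<N. periodized_coef N y ((int J - int I) mod int N) * z ^ J) * v1"
      by (simp add: sum.distrib sum_distrib_right mult.assoc)
    then show ?thesis
      unfolding circulant_row_sum[OF \<open>N > 0\<close> zN] sum_periodized_coef[OF \<open>N > 0\<close> zN] by (simp add: algebra_simps)
  qed
  have "circ_mat \<omega> T a d q *\<^sub>v w = c \<cdot>\<^sub>v w"
  proof (rule eq_vecI)
    fix i assume "i < dim_vec (c \<cdot>\<^sub>v w)"
    then have "i < 2 * N" by (simp add: dim)
    then show "vec_index (circ_mat \<omega> T a d q *\<^sub>v w) i = vec_index (c \<cdot>\<^sub>v w) i"
    proof (cases rule: even_odd_less_double)
      case (1 I)
      have "vec_index (circ_mat \<omega> T a d q *\<^sub>v w) (2 * I) = z ^ I * (c * v0)"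
        unfolding circ_mat_mult_nth(1)[OF dim N_def 1(1)] v(2)[symmetric] comb[symmetric]
        by (intro sum.cong refl) (simp add: w del: One_nat_def)
      then show ?thesis using 1 by (simp add: dim w)
    next
      case (2 I)
      have "vec_index (circ_mat \<omega> T a d q *\<^sub>v w) (2 * I + 1) = z ^ I * (c * v1)"
        unfolding circ_mat_mult_nth(2)[OF dim N_def 2(1)] v(3)[symmetric] comb[symmetric]
        by (intro sum.cong refl) (simp add: w del: One_nat_def)
      then show ?thesis using 2 w(2)[OF 2(1)] by (simp add: dim)
    qed
  qed (simp add: dim dim_row_circ_mat N_def)
  moreover have "w \<noteq> 0\<^sub>v (2 * N)"
  proof
    assume "w = 0\<^sub>v (2 * N)"
    then have "vec_index w (2 * 0) = 0" "vec_index w (2 * 0 + 1) = 0"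
      using \<open>N > 0\<close> by simp_all
    then show False using w[OF \<open>N > 0\<close>] v(1) by simp
  qed
  ultimately have "eigenvector (circ_mat \<omega> T a d q) w c"
    unfolding eigenvector_def dim_row_circ_mat N_def[symmetric] using carrier_vecI[OF dim] by blast
  then show ?thesis by (auto simp: mat_spectrum_def eigenvalue_def)
qed

text \<open>The discrete Fourier transform of an eigenvector solves the eigenvalue equation of the
  symbol at every root of unity. By Parseval it is nonzero at one of them, which supplies the root
  \<open>z\<close>.\<close>

lemma mat_spectrum_circ_matE:
  assumes "c \<in> mat_spectrum (circ_mat \<omega> T a d q)"
  obtains z where "z ^ (1 + q) = 1" "c \<in> symbol_eigenvalues z"
proof -
  define N where "N = 1 + q"
  have "N > 0" by (simp add: N_def)
  obtain w where dim: "dim_vec w = 2 * N" and "w \<noteq> 0\<^sub>v (2 * N)"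
    and Cw: "circ_mat \<omega> T a d q *\<^sub>v w = c \<cdot>\<^sub>v w"
    using assms unfolding mat_spectrum_def eigenvalue_def eigenvector_def dim_row_circ_mat N_def[symmetric]
    using carrier_vecD by blast
  \<comment> \<open>The transform of component \<open>r\<close> of the blocks; index
    \<open>2 * I + r\<close> of \<open>w\<close> is component \<open>r\<close> of block
    \<open>I\<close>.\<close>
  define h where "h r y = (\<Sum>I<N. y ^ I * vec_index w (2 * I + r))" for r :: nat and y :: complex
  have rows:
    "c * vec_index w (2 * I) = (\<Sum>J<N. periodized_coef N 0 ((int J - int I) mod int N) * vec_index w (2 * J)
              + periodized_coef N (-2 * a) ((int J - int I) mod int N) * vec_index w (2 * J + 1))"
    "c * vec_index w (2 * I + 1) = (\<Sum>J<N. periodized_coef N (2 * a) ((int J - int I) mod int N) * vec_index w (2 * J)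
              + periodized_coef N 0 ((int J - int I) mod int N) * vec_index w (2 * J + 1))" if "I < N" for I
    using circ_mat_mult_nth[OF dim N_def that] that unfolding Cw by (simp_all add: dim)
  have dft: "(\<Sum>I<N. inverse z ^ I * (\<Sum>J<N. periodized_coef N x ((int J - int I) mod int N) * vec_index w (2 * J)
              + periodized_coef N y ((int J - int I) mod int N) * vec_index w (2 * J + 1)))
      = scalar_symbol x z * h 0 (inverse z) + scalar_symbol y z * h 1 (inverse z)" if zN: "z ^ N = 1" for z x y
  proof -
    have one: "(\<Sum>I<N. inverse z ^ I * (\<Sum>J<N. periodized_coef N x ((int J - int I) mod int N) * g J))
       = scalar_symbol x z * (\<Sum>J<N. inverse z ^ J * g J)" for x and g :: "nat \<Rightarrow> complex"
    proof -
      have "(\<Sum>I<N. inverse z ^ I * (\<Sum>J<N. periodized_coef N x ((int J - int I) mod int N) * g J))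
         = (\<Sum>J<N. (\<Sum>I<N. periodized_coef N x ((int J - int I) mod int N) * inverse z ^ I) * g J)"
        unfolding sum_distrib_left sum_distrib_right by (subst sum.swap) (simp add: mult_ac)
      then show ?thesis
        unfolding circulant_column_sum[OF \<open>N > 0\<close> zN] sum_periodized_coef[OF \<open>N > 0\<close> zN]
        by (simp add: sum_distrib_left mult_ac)
    qed
    show ?thesis
      unfolding sum.distrib distrib_left one h_def by simp
  qed
  have "\<exists>y. y ^ N = 1 \<and> (h 0 y \<noteq> 0 \<or> h 1 y \<noteq> 0)"
  proof (rule ccontr)
    assume none: "\<not> ?thesis"
    have zero: "vec_index w (2 * I + r) = 0" if "I < N" "r = 0 \<or> r = 1" for I r
    proof -
      define f where "f i = vec_index w (2 * nat i + r)" for i :: int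
      have h: "(\<Sum>i\<in>int ` {..<N}. y powi i * f i) = h r y" for y
        unfolding h_def by (subst sum.reindex) (auto simp: f_def)
      have "i = j" if "i \<in> int ` {..<N}" "j \<in> int ` {..<N}" "int N dvd i - j" for i j
      proof (rule ccontr)
        assume "i \<noteq> j"
        with that(3) have "int N \<le> \<bar>i - j\<bar>"
          by (intro dvd_imp_le_int[of "i - j" "int N", simplified]) auto
        then show False using that(1,2) by auto
      qed
      from parseval_roots_unity[where f = f and W = "int ` {..<N}", OF \<open>N > 0\<close> _ this]
      have "of_nat N * (\<Sum>i\<in>int ` {..<N}. (norm (f i))\<^sup>2) = (\<Sum>y | y ^ N = 1. (norm (h r y))\<^sup>2)"
        by (simp add: h)
      also have "\<dots> = 0"
        using none that(2) by (intro sum.neutral) auto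
      finally have "(\<Sum>i\<in>int ` {..<N}. (norm (f i))\<^sup>2) = 0"
        using \<open>N > 0\<close> by simp
      then have "f (int I) = 0"
        using that(1) by (subst (asm) sum_nonneg_eq_0_iff) auto
      then show ?thesis by (simp add: f_def)
    qed
    have "w = 0\<^sub>v (2 * N)"
    proof (rule eq_vecI)
      fix i assume "i < dim_vec (0\<^sub>v (2 * N) :: complex Matrix.vec)"
      then have "i < 2 * N" by simp
      then show "vec_index w i = vec_index (0\<^sub>v (2 * N)) i"
        by (cases rule: even_odd_less_double) (use zero[of _ 0] zero[of _ 1] in auto)
    qed (simp add: dim)
    with \<open>w \<noteq> 0\<^sub>v (2 * N)\<close> show False ..
  qed
  then obtain y where y: "y ^ N = 1" "h 0 y \<noteq> 0 \<or> h 1 y \<noteq> 0" by blast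
  \<comment> \<open>The column sums pair inverse powers with the symbol at \<open>z\<close>, hence
    the inversion.\<close>
  define z where "z = inverse y"
  have zN: "z ^ N = 1" and yz: "inverse z = y" using y(1) by (simp_all add: z_def power_inverse)
  have "scalar_symbol 0 z * h 0 y + scalar_symbol (-2 * a) z * h 1 y = c * h 0 y"
  proof -
    have "(\<Sum>I<N. y ^ I * (c * vec_index w (2 * I))) = scalar_symbol 0 z * h 0 y + scalar_symbol (-2 * a) z * h 1 y"
      unfolding dft[OF zN, unfolded yz, symmetric]
      by (intro sum.cong refl) (simp only: rows lessThan_iff)
    then show ?thesis by (simp add: h_def sum_distrib_left mult_ac)
  qed
  moreover have "scalar_symbol (2 * a) z * h 0 y + scalar_symbol 0 z * h 1 y = c * h 1 y"
  proof -
    have "(\<Sum>I<N. y ^ I * (c * vec_index w (2 * I + 1))) = scalar_symbol (2 * a) z * h 0 y + scalar_symbol 0 z * h 1 y"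
      unfolding dft[OF zN, unfolded yz, symmetric]
      by (intro sum.cong refl) (simp only: rows lessThan_iff)
    then show ?thesis by (simp add: h_def sum_distrib_left mult_ac)
  qed
  ultimately have "c \<in> symbol_eigenvalues z"
    unfolding symbol_eigenvalues_iff[OF norm_root_unity[OF \<open>N > 0\<close> zN]] using y(2) by blast
  then show ?thesis using that zN by (simp add: N_def)
qed

end

section \<open>Density of the roots of unity and comparison of the two spectra\<close>

lemma closure_roots_unity: "closure {z::complex. \<exists>q\<ge>1. z ^ (1 + q) = 1} = sphere 0 1"
proof
  have "{z::complex. \<exists>q\<ge>1. z ^ (1 + q) = 1} \<subseteq> sphere 0 1"
    using norm_root_unity[of "1 + _"] by (auto simp del: power_Suc)
  then show "closure {z::complex. \<exists>q\<ge>1. z ^ (1 + q) = 1} \<subseteq> sphere 0 1"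
    by (intro closure_minimal) auto
  show "sphere 0 1 \<subseteq> closure {z::complex. \<exists>q\<ge>1. z ^ (1 + q) = 1}"
  proof
    fix z :: complex assume "z \<in> sphere 0 1"
    then have "norm z = 1" by simp
    then have "z = cis (Arg z)"
      using cis_Arg[of z] by (cases "z = 0") (simp_all add: sgn_div_norm)
    define t where "t = Arg z / (2 * pi)"
    have zt: "z = cis (2 * pi * t)" using \<open>z = cis (Arg z)\<close> by (simp add: t_def)
    \<comment> \<open>The angle is rounded down to a multiple of \<open>1 / (n + 2)\<close> of a
      full turn; the offset 2 makes \<open>q = n + 1\<close> at least 1.\<close>
    define x where "x n = cis (2 * pi * (of_int \<lfloor>t * real (n + 2)\<rfloor> / real (n + 2)))" for n :: nat
    have "x n \<in> {z. \<exists>q\<ge>1. z ^ (1 + q) = 1}" for n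
    proof -
      have "x n ^ (n + 2) = cis (real (n + 2) * (2 * pi * (of_int \<lfloor>t * real (n + 2)\<rfloor> / real (n + 2))))"
        unfolding x_def by (rule Complex.DeMoivre)
      also have "real (n + 2) * (2 * pi * (of_int \<lfloor>t * real (n + 2)\<rfloor> / real (n + 2)))
         = 2 * pi * of_int \<lfloor>t * real (n + 2)\<rfloor>"
        by (simp add: field_simps)
      also have "cis \<dots> = 1" by (rule cis_multiple_2pi) simp
      finally show ?thesis by (intro CollectI exI[of _ "n + 1"]) simp
    qed
    moreover have "x \<longlonglongrightarrow> z"
    proof -
      have "(\<lambda>n::nat. of_int \<lfloor>t * real (n + 2)\<rfloor> / real (n + 2)) \<longlonglongrightarrow> t"
        by real_asymp
      then show ?thesis unfolding x_def zt by (intro tendsto_intros)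
    qed
    ultimately show "z \<in> closure {z. \<exists>q\<ge>1. z ^ (1 + q) = 1}"
      unfolding closure_sequential by blast
  qed
qed

text \<open>The image of the compact \<open>S\<close> is closed and contains the image of
  \<open>R\<close>; continuity on the closure of \<open>R\<close> gives the other inclusion.\<close>

lemma closure_continuous_image_dense:
  fixes f :: "'a::metric_space \<Rightarrow> 'b::metric_space"
  assumes "compact S" "closure R = S" "continuous_on S f"
  shows "closure (f ` R) = f ` S"
proof
  have "R \<subseteq> S" using assms(2) closure_subset by blast
  then show "closure (f ` R) \<subseteq> f ` S"
    using assms by (intro closure_minimal image_mono compact_imp_closed compact_continuous_image)
  show "f ` S \<subseteq> closure (f ` R)"
    using image_closure_subset[of R f "closure (f ` R)"] assms closure_subset[of "f ` R"] by simp
qed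

theorem theorem4:
  fixes \<omega> u :: "real \<Rightarrow> real" and h T a :: real
  assumes "kernel_ok \<omega>"
    and "T > 0" and "0 < a" and "a < T / 2"
    and "regular_1bump u T h a"
    and "is_solution \<omega> h u"
  shows "linf_spectrum (laurent_op (Ablock \<omega> T a \<bar>deriv u a\<bar>)) =
         closure (\<Union>q\<in>{1..}. mat_spectrum (circ_mat \<omega> T a \<bar>deriv u a\<bar> q))"
proof -
  interpret periodized_kernel \<omega> T a "\<bar>deriv u a\<bar>"
    using assms by unfold_locales
  let ?R = "{z::complex. \<exists>q\<ge>1. z ^ (1 + q) = 1}" and ?S = "sphere 0 1 :: complex set"
  \<comment> \<open>Following the two eigenvalues as separate continuous functions reduces the claim
    to images of a dense set, because closure commutes with finite unions.\<close>
  define fp fm where "fp z = scalar_symbol 0 z + of_real (norm (scalar_symbol (-2 * a) z))"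
    and "fm z = scalar_symbol 0 z - of_real (norm (scalar_symbol (-2 * a) z))" for z
  have eigs: "symbol_eigenvalues z = {fp z, fm z}" for z by (simp add: symbol_eigenvalues_def fp_def fm_def)
  have cont: "continuous_on ?S fp" "continuous_on ?S fm"
    unfolding fp_def fm_def by (intro continuous_intros continuous_on_scalar_symbol)+
  have "(\<Union>q\<in>{1..}. mat_spectrum (circ_mat \<omega> T a \<bar>deriv u a\<bar> q)) = (\<Union>z\<in>?R. symbol_eigenvalues z)"
  proof (intro subset_antisym subsetI)
    fix c assume "c \<in> (\<Union>q\<in>{1..}. mat_spectrum (circ_mat \<omega> T a \<bar>deriv u a\<bar> q))"
    then obtain q where "q \<ge> 1" and c: "c \<in> mat_spectrum (circ_mat \<omega> T a \<bar>deriv u a\<bar> q)" by auto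
    from c obtain z where "z ^ (1 + q) = 1" "c \<in> symbol_eigenvalues z" by (rule mat_spectrum_circ_matE)
    with \<open>q \<ge> 1\<close> show "c \<in> (\<Union>z\<in>?R. symbol_eigenvalues z)" by blast
  next
    fix c assume "c \<in> (\<Union>z\<in>?R. symbol_eigenvalues z)"
    then obtain z q where "q \<ge> 1" "z ^ (1 + q) = 1" "c \<in> symbol_eigenvalues z" by blast
    then show "c \<in> (\<Union>q\<in>{1..}. mat_spectrum (circ_mat \<omega> T a \<bar>deriv u a\<bar> q))"
      using symbol_eigenvalue_in_mat_spectrum by auto
  qed
  also have "closure \<dots> = closure (fp ` ?R) \<union> closure (fm ` ?R)"
    unfolding closure_Un[symmetric] by (rule arg_cong[where f = closure]) (auto simp: eigs)
  also have "\<dots> = fp ` ?S \<union> fm ` ?S"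
    by (simp only: closure_continuous_image_dense[OF compact_sphere closure_roots_unity] cont)
  also have "\<dots> = (\<Union>z\<in>?S. symbol_eigenvalues z)" by (auto simp: eigs)
  finally show ?thesis by (simp add: linf_spectrum_eq)
qed

end
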